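(* Let $a,b>0$, $p>1$, and let $x^*\in\mathbb{R}^2$ be fixed. If $x^*\in\mathcal{D}_p$, then its metric projection onto $\mathcal{D}_p$ is $x^*$. Otherwise, if $x^*\in\mathbb{R}^2\setminus\mathcal{D}_p$, then for any initial integer $k\ge 3$, the sequence $(x^n)_{n\ge1}$ generated by the algorithm described below converges to the metric projection of $x^*$ onto the superellipse $\mathcal{C}_p$ (the point of $\mathcal{C}_p$ nearest to $x^*$).
   Context: $\|(x,y)\|_p=\left(|x/a|^p+|y/b|^p\right)^{1/p}$; $\mathcal{C}_p=\{(x,y)\mid |x/a|^p+|y/b|^p=1\}$; $\mathcal{D}_p=\{(x,y)\mid |x/a|^p+|y/b|^p\le1\}=\operatorname{conv}(\mathcal{C}_p)$. Distances and metric projections are Euclidean. For an integer $m\ge3$, $\mathcal{P}_{p,m}$ is the closed polygon with vertices $P^{(m)}_t=\varphi_p\!\left(\cos\frac{2t\pi}{m},\sin\frac{2t\pi}{m}\right)$, $t=0,\dots,m-1$, where $\varphi_p(u,v)=(u,v)/\|(u,v)\|_p$, and edges $[P^{(m)}_t,P^{(m)}_{t+1}]$ (indices mod $m$); $\mathcal{Q}_{p,m}=\operatorname{conv}(\mathcal{P}_{p,m})$. Algorithm (for $x^*\notin\mathcal{D}_p$, initial $k\ge3$): Step 1: $x^1$ is the metric projection of $x^*$ onto $\mathcal{P}_{p,k}$; it lies either in the relative interior of a unique edge $[P^{(k)}_t,P^{(k)}_{t+1}]$ or equals a vertex $P^{(k)}_t$. Refinement step: given $x^n$ the projection of $x^*$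 onto $\mathcal{P}_{p,m}$ ($m=2^{n-1}k$), pass to $\mathcal{P}_{p,2m}$ with vertices $Q_l=P^{(2m)}_l$ (so $P^{(m)}_t=Q_{2t}$). If $x^n$ lies in the relative interior of the edge $[P^{(m)}_t,P^{(m)}_{t+1}]$, compute the projections of $x^*$ onto the edges $[Q_{2t},Q_{2t+1}]$ and $[Q_{2t+1},Q_{2t+2}]$; if $x^n=P^{(m)}_t$, compute the projections of $x^*$ onto $[Q_{2t-1},Q_{2t}]$ and $[Q_{2t},Q_{2t+1}]$ (indices mod $2m$). Then $x^{n+1}$ is whichever of these two projections is nearer to $x^*$; it is the metric projection of $x^*$ onto $\mathcal{P}_{p,2m}$. *)

theory Defs
  imports "HOL-Analysis.Analysis"
begin

text \<open>Points of the plane are modelled as real \<times> real; the product metric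
  on this type is the Euclidean one.\<close>

definition pnorm :: "real \<Rightarrow> real \<Rightarrow> real \<Rightarrow> real \<times> real \<Rightarrow> real" where
  "pnorm a b p z = (\<bar>fst z / a\<bar> powr p + \<bar>snd z / b\<bar> powr p) powr (1 / p)"

definition superellipse :: "real \<Rightarrow> real \<Rightarrow> real \<Rightarrow> (real \<times> real) set" where
  "superellipse a b p = {z. \<bar>fst z / a\<bar> powr p + \<bar>snd z / b\<bar> powr p = 1}"

definition superdisk :: "real \<Rightarrow> real \<Rightarrow> real \<Rightarrow> (real \<times> real) set" where
  "superdisk a b p = {z. \<bar>fst z / a\<bar> powr p + \<bar>snd z / b\<bar> powr p \<le> 1}"

definition is_proj :: "(real \<times> real) set \<Rightarrow> real \<times> real \<Rightarrow> real \<times> real \<Rightarrow> bool" where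
  "is_proj S x y \<longleftrightarrow> y \<in> S \<and> (\<forall>z\<in>S. dist x y \<le> dist x z)"

definition phi :: "real \<Rightarrow> real \<Rightarrow> real \<Rightarrow> real \<times> real \<Rightarrow> real \<times> real" where
  "phi a b p z = inverse (pnorm a b p z) *\<^sub>R z"

definition vert :: "real \<Rightarrow> real \<Rightarrow> real \<Rightarrow> nat \<Rightarrow> nat \<Rightarrow> real \<times> real" where
  "vert a b p m t = phi a b p (cos (2 * real (t mod m) * pi / real m),
                               sin (2 * real (t mod m) * pi / real m))"

definition polygon :: "real \<Rightarrow> real \<Rightarrow> real \<Rightarrow> nat \<Rightarrow> (real \<times> real) set" where
  "polygon a b p m = (\<Union>t<m. closed_segment (vert a b p m t) (vert a b p m (Suc t)))"

definition edge_proj :: "real \<Rightarrow> real \<Rightarrow> real \<Rightarrow> nat \<Rightarrow> nat \<Rightarrow> real \<times> real \<Rightarrow> real \<times> real" where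
  "edge_proj a b p M i x = closest_point (closed_segment (vert a b p M i) (vert a b p M (Suc i))) x"

text \<open>One refinement step of the algorithm: from x^n (projection onto P_{p,m}) to x^{n+1}.
  Indices i-1 mod 2m are written as i + 2m - 1.\<close>
definition refine_step ::
  "real \<Rightarrow> real \<Rightarrow> real \<Rightarrow> real \<times> real \<Rightarrow> nat \<Rightarrow> real \<times> real \<Rightarrow> real \<times> real \<Rightarrow> bool" where
  "refine_step a b p xs m xn xn1 \<longleftrightarrow>
     (\<exists>t<m.
        (xn \<in> open_segment (vert a b p m t) (vert a b p m (Suc t)) \<and>
          (let c1 = edge_proj a b p (2*m) (2*t) xs; c2 = edge_proj a b p (2*m) (2*t+1) xs in
           xn1 \<in> {c1, c2} \<and> dist xs xn1 \<le> dist xs c1 \<and> dist xs xn1 \<le> dist xs c2))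
      \<or> (xn = vert a b p m t \<and>
          (let c1 = edge_proj a b p (2*m) (2*t + 2*m - 1) xs; c2 = edge_proj a b p (2*m) (2*t) xs in
           xn1 \<in> {c1, c2} \<and> dist xs xn1 \<le> dist xs c1 \<and> dist xs xn1 \<le> dist xs c2)))"

definition algorithm_seq ::
  "real \<Rightarrow> real \<Rightarrow> real \<Rightarrow> real \<times> real \<Rightarrow> nat \<Rightarrow> (nat \<Rightarrow> real \<times> real) \<Rightarrow> bool" where
  "algorithm_seq a b p xs k x \<longleftrightarrow>
     is_proj (polygon a b p k) xs (x 1) \<and>
     (\<forall>n\<ge>1. refine_step a b p xs (2^(n-1) * k) (x n) (x (Suc n)))"

end

theory Submission
  imports Defs
begin

text \<open>The superdisk is strictly convex, so the vertices of each polygon are in convex position and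
  the projection onto the polygon is the projection onto its convex hull.

  A refinement only adds, beyond each edge, the triangle spanned by the new vertex. If the old
  projection lies inside an edge, the line through that edge separates all other parts of the refined
  polygon from the point; if it is a vertex \<open>P\<close>, the line through \<open>P\<close> orthogonal to the projection
  direction does so, except possibly for the outer halves of the two triangles at \<open>P\<close>. These are
  excluded because the angles at the base of each triangle are acute, which depends on the position
  of the vertices relative to the symmetry axes. Thus every \<open>x\<^sup>n\<close> is the projection onto the
  \<open>n\<close>-th polygon.

  As the vertices become dense in the superellipse, the distance from \<open>x\<^sup>*\<close> to \<open>x\<^sup>n\<close> tends to the
  distance from \<open>x\<^sup>*\<close> to the superdisk, and the obtuse-angle property of convex projections turns
  this into convergence.\<close>

section \<open>Strict convexity\<close>

text \<open>Let \<open>c\<close> be the convex combination. The mean value theorem on either side of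
  \<open>c\<close> yields slopes \<open>p * \<xi> powr (p - 1)\<close> and
  \<open>p * \<eta> powr (p - 1)\<close> with \<open>\<xi> < c < \<eta>\<close>, and the second is
  larger because \<open>p > 1\<close>.\<close>

lemma powr_strict_convex_nonneg:
  fixes x y u p :: real
  assumes "p > 1" "0 \<le> x" "x < y" "0 < u" "u < 1"
  shows "((1 - u) * x + u * y) powr p < (1 - u) * x powr p + u * y powr p"
proof -
  define c where "c = (1 - u) * x + u * y"
  have c1: "c - x = u * (y - x)" and c2: "y - c = (1 - u) * (y - x)"
    by (auto simp: c_def algebra_simps)
  have "0 < c - x" "0 < y - c"
    unfolding c1 c2 using assms by auto
  then have "x < c" "c < y"
    by auto
  have mvt: "\<exists>z. s < z \<and> z < t \<and> t powr p - s powr p = (t - s) * (p * z powr (p - 1))"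
    if "0 \<le> s" "s < t" for s t
  proof -
    have "continuous_on {s..t} (\<lambda>z. z powr p)"
      using that assms by (intro continuous_on_powr' continuous_intros) auto
    moreover have der: "((\<lambda>z. z powr p) has_real_derivative (p * z powr (p - 1))) (at z)" if "s < z" for z
      using that \<open>0 \<le> s\<close> by (auto intro!: derivative_eq_intros)
    ultimately obtain l z where z: "s < z" "z < t" "DERIV (\<lambda>z. z powr p) z :> l"
      "t powr p - s powr p = (t - s) * l"
      using MVT[OF \<open>s < t\<close>, of "\<lambda>z. z powr p"] unfolding real_differentiable_def by blast
    with der[of z] have "l = p * z powr (p - 1)"
      using DERIV_unique by blast
    with z show ?thesis by auto
  qed
  obtain \<xi> where \<xi>: "x < \<xi>" "\<xi> < c" "c powr p - x powr p = (c - x) * (p * \<xi> powr (p - 1))"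
    using mvt[OF assms(2) \<open>x < c\<close>] by auto
  obtain \<eta> where \<eta>: "c < \<eta>" "\<eta> < y" "y powr p - c powr p = (y - c) * (p * \<eta> powr (p - 1))"
    using mvt[of c y] assms(2) \<open>x < c\<close> \<open>c < y\<close> by auto
  have "\<xi> powr (p - 1) < \<eta> powr (p - 1)"
    using \<xi> \<eta> assms by (intro powr_less_mono2) auto
  then have "(u * (1 - u) * (y - x) * p) * \<xi> powr (p - 1) < (u * (1 - u) * (y - x) * p) * \<eta> powr (p - 1)"
    using assms by (intro mult_strict_left_mono) auto
  moreover have "(1 - u) * (c powr p - x powr p) = (u * (1 - u) * (y - x) * p) * \<xi> powr (p - 1)"
    unfolding \<xi> c1 by simp
  moreover have "u * (y powr p - c powr p) = (u * (1 - u) * (y - x) * p) * \<eta> powr (p - 1)"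
    unfolding \<eta> c2 by simp
  ultimately have "(1 - u) * (c powr p - x powr p) < u * (y powr p - c powr p)"
    by linarith
  then show ?thesis
    unfolding c_def[symmetric] by (simp add: algebra_simps)
qed

text \<open>Strictness has two sources. If the absolute values differ, it comes from strict
  convexity on the nonnegative reals; if they agree, then \<open>y = - x\<close> with
  \<open>x \<noteq> 0\<close>, and cancellation makes the combination strictly smaller in absolute
  value.\<close>

lemma abs_powr_strict_convex:
  fixes x y u p :: real
  assumes "p > 1" "x \<noteq> y" "0 < u" "u < 1"
  shows "\<bar>(1 - u) * x + u * y\<bar> powr p < (1 - u) * \<bar>x\<bar> powr p + u * \<bar>y\<bar> powr p"
proof -
  have tri: "\<bar>(1 - u) * x + u * y\<bar> \<le> (1 - u) * \<bar>x\<bar> + u * \<bar>y\<bar>"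
    using abs_triangle_ineq[of "(1 - u) * x" "u * y"] assms by (simp add: abs_mult)
  show ?thesis
  proof (cases "\<bar>x\<bar> = \<bar>y\<bar>")
    case True
    with assms have y: "y = - x" "x \<noteq> 0" by (auto simp: abs_eq_iff)
    have "(1 - u) * x + u * y = (1 - 2 * u) * x"
      by (simp add: y algebra_simps)
    moreover have "\<bar>1 - 2 * u\<bar> * \<bar>x\<bar> < 1 * \<bar>x\<bar>"
      using assms y by (intro mult_strict_right_mono) auto
    ultimately have "\<bar>(1 - u) * x + u * y\<bar> < \<bar>x\<bar>"
      by (simp add: abs_mult)
    then have "\<bar>(1 - u) * x + u * y\<bar> powr p < \<bar>x\<bar> powr p"
      using assms by (intro powr_less_mono2) auto
    also have "\<dots> = (1 - u) * \<bar>x\<bar> powr p + u * \<bar>y\<bar> powr p"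
      unfolding True[symmetric] by (simp add: algebra_simps)
    finally show ?thesis .
  next
    case False
    have "\<bar>(1 - u) * x + u * y\<bar> powr p \<le> ((1 - u) * \<bar>x\<bar> + u * \<bar>y\<bar>) powr p"
      using tri assms by (intro powr_mono2) auto
    also have "\<dots> < (1 - u) * \<bar>x\<bar> powr p + u * \<bar>y\<bar> powr p"
    proof (cases "\<bar>x\<bar> < \<bar>y\<bar>")
      case True
      then show ?thesis
        using powr_strict_convex_nonneg[of p "\<bar>x\<bar>" "\<bar>y\<bar>" u] assms by auto
    next
      case f: False
      then show ?thesis
        using powr_strict_convex_nonneg[of p "\<bar>y\<bar>" "\<bar>x\<bar>" "1 - u"] assms False
        by (auto simp: add.commute)
    qed
    finally show ?thesis .
  qed
qed

section \<open>Gauge, signed area and polar parametrization\<close>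

definition sform :: "real \<Rightarrow> real \<Rightarrow> real \<Rightarrow> real \<times> real \<Rightarrow> real" where
  "sform a b p z = \<bar>fst z / a\<bar> powr p + \<bar>snd z / b\<bar> powr p"

definition det2 :: "real \<times> real \<Rightarrow> real \<times> real \<Rightarrow> real" where
  "det2 z w = fst z * snd w - snd z * fst w"

text \<open>Twice the signed area of the triangle \<open>P\<close>, \<open>Q\<close>,
  \<open>R\<close>, positive when it is traversed counterclockwise.\<close>

definition orient :: "real \<times> real \<Rightarrow> real \<times> real \<Rightarrow> real \<times> real \<Rightarrow> real" where
  "orient P Q R = det2 (Q - P) (R - P)"

text \<open>The parameter is the polar angle of the point itself, so signs of \<open>det2\<close> on
  the curve are signs of sines.\<close>

definition curve :: "real \<Rightarrow> real \<Rightarrow> real \<Rightarrow> real \<Rightarrow> real \<times> real" where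
  "curve a b p \<theta> = phi a b p (cos \<theta>, sin \<theta>)"

lemma polar_form:
  fixes z :: "real \<times> real"
  obtains \<theta> where "0 \<le> \<theta>" "\<theta> < 2 * pi" "z = norm z *\<^sub>R (cos \<theta>, sin \<theta>)"
proof (cases "z = 0")
  case True
  then show ?thesis using that[of 0] by (simp add: zero_prod_def)
next
  case False
  define x y where "x = fst z" and "y = snd z"
  have n: "norm z > 0" using False by simp
  have "(norm z)\<^sup>2 = x\<^sup>2 + y\<^sup>2"
    by (simp add: x_def y_def norm_prod_def)
  moreover have "(x / norm z)\<^sup>2 + (y / norm z)\<^sup>2 = (x\<^sup>2 + y\<^sup>2) / (norm z)\<^sup>2"
    by (simp add: power_divide add_divide_distrib)
  moreover have "(norm z)\<^sup>2 \<noteq> 0"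
    using n by simp
  ultimately have "(x / norm z)\<^sup>2 + (y / norm z)\<^sup>2 = 1"
    by (metis divide_self)
  then obtain \<theta> where \<theta>: "0 \<le> \<theta>" "\<theta> < 2 * pi" "x / norm z = cos \<theta>" "y / norm z = sin \<theta>"
    using sincos_total_2pi by metis
  have "z = norm z *\<^sub>R (cos \<theta>, sin \<theta>)"
    unfolding \<theta>(3,4)[symmetric] using n by (simp add: x_def y_def prod_eq_iff)
  with \<theta> that show ?thesis by blast
qed

locale superellipse_params =
  fixes a b p :: real
  assumes a_pos: "a > 0" and b_pos: "b > 0" and p_gt_1: "p > 1"
begin

abbreviation "F \<equiv> sform a b p"
abbreviation "g \<equiv> curve a b p"
abbreviation "D \<equiv> superdisk a b p"
abbreviation "C \<equiv> superellipse a b p"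

lemma D_eq: "D = {z. F z \<le> 1}" and C_eq: "C = {z. F z = 1}"
  by (auto simp: superdisk_def superellipse_def sform_def)

lemma sform_scale: "F (s *\<^sub>R z) = \<bar>s\<bar> powr p * F z"
proof -
  have "\<bar>s * x / c\<bar> powr p = \<bar>s\<bar> powr p * \<bar>x / c\<bar> powr p" for x c
    by (metis abs_ge_zero abs_mult powr_mult times_divide_eq_right)
  then show ?thesis
    by (simp add: sform_def distrib_left)
qed

lemma sform_pos:
  assumes "z \<noteq> 0"
  shows "F z > 0"
  using assms a_pos b_pos p_gt_1
  by (cases z) (auto simp: sform_def zero_prod_def add_pos_nonneg add_nonneg_pos)

text \<open>\<open>sform\<close> is the p-th power of \<open>pnorm\<close>; unlike that norm, which
  is linear on rays, it is strictly convex on the whole plane. Distinct points differ in some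
  coordinate, and the summand of that coordinate gives strictness.\<close>

lemma sform_strict_convex:
  assumes "z \<noteq> w" "0 < u" "u < 1"
  shows "F ((1 - u) *\<^sub>R z + u *\<^sub>R w) < (1 - u) * F z + u * F w"
proof -
  have le: "\<bar>((1 - u) * x + u * y) / c\<bar> powr p \<le> (1 - u) * \<bar>x / c\<bar> powr p + u * \<bar>y / c\<bar> powr p"
    and lt: "x \<noteq> y \<Longrightarrow> \<bar>((1 - u) * x + u * y) / c\<bar> powr p < (1 - u) * \<bar>x / c\<bar> powr p + u * \<bar>y / c\<bar> powr p"
    if "c > 0" for x y c
  proof -
    have eq: "((1 - u) * x + u * y) / c = (1 - u) * (x / c) + u * (y / c)"
      by (simp add: add_divide_distrib)
    show *: "\<bar>((1 - u) * x + u * y) / c\<bar> powr p < (1 - u) * \<bar>x / c\<bar> powr p + u * \<bar>y / c\<bar> powr p"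
      if "x \<noteq> y"
      unfolding eq using assms p_gt_1 that \<open>c > 0\<close> by (intro abs_powr_strict_convex) auto
    show "\<bar>((1 - u) * x + u * y) / c\<bar> powr p \<le> (1 - u) * \<bar>x / c\<bar> powr p + u * \<bar>y / c\<bar> powr p"
      using * by (cases "x = y") (auto simp: algebra_simps)
  qed
  show ?thesis
    using le[OF a_pos, of "fst z" "fst w"] lt[OF a_pos, of "fst z" "fst w"]
      le[OF b_pos, of "snd z" "snd w"] lt[OF b_pos, of "snd z" "snd w"] assms(1)
    by (cases z; cases w) (auto simp: sform_def algebra_simps)
qed

lemma convex_D: "convex D"
proof (rule convexI)
  fix x y and u v :: real
  assume *: "x \<in> D" "y \<in> D" "0 \<le> u" "0 \<le> v" "u + v = 1"
  show "u *\<^sub>R x + v *\<^sub>R y \<in> D"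
  proof (cases "x = y \<or> v = 0 \<or> v = 1")
    case True
    with * show ?thesis
      by (auto simp flip: scaleR_add_left)
  next
    case False
    with * have "F ((1 - v) *\<^sub>R x + v *\<^sub>R y) < (1 - v) * F x + v * F y"
      by (intro sform_strict_convex) auto
    also have "\<dots> \<le> (1 - v) * 1 + v * 1"
      using * by (intro add_mono mult_left_mono) (auto simp: D_eq)
    moreover have "u = 1 - v" using * by auto
    ultimately show ?thesis by (simp add: D_eq)
  qed
qed

lemma continuous_sform: "continuous_on UNIV F"
  unfolding sform_def
  using a_pos b_pos p_gt_1 by (intro continuous_intros continuous_on_powr') auto

lemma closed_D: "closed D"
  unfolding D_eq by (intro closed_Collect_le continuous_sform continuous_intros)

lemma sform_curve: "F (g \<theta>) = 1"
  and curve_polar: "\<exists>r>0. g \<theta> = r *\<^sub>R (cos \<theta>, sin \<theta>)"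
proof -
  define u where "u = (cos \<theta>, sin \<theta>)"
  have "u \<noteq> 0"
    using sin_zero_abs_cos_one[of \<theta>] by (auto simp: u_def zero_prod_def)
  then have pos: "F u > 0" by (rule sform_pos)
  have gu: "g \<theta> = inverse (F u powr (1 / p)) *\<^sub>R u"
    by (simp add: curve_def phi_def pnorm_def sform_def u_def)
  show "F (g \<theta>) = 1"
    using pos p_gt_1 by (simp add: gu sform_scale powr_powr inverse_powr)
  show "\<exists>r>0. g \<theta> = r *\<^sub>R (cos \<theta>, sin \<theta>)"
    using pos unfolding gu u_def by (intro exI[of _ "inverse (F u powr (1 / p))"]) (auto simp: u_def)
qed

lemma curve_in_D: "g \<theta> \<in> D"
  by (simp add: D_eq sform_curve)

lemma continuous_curve: "continuous_on UNIV g"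
proof -
  have nz: "F (cos \<theta>, sin \<theta>) \<noteq> 0" for \<theta>
    using sform_pos[of "(cos \<theta>, sin \<theta>)"] sin_zero_abs_cos_one[of \<theta>] 
    by (force simp: zero_prod_def)
  have "continuous_on UNIV (\<lambda>\<theta>. F (cos \<theta>, sin \<theta>))"
    by (intro continuous_on_compose2[OF continuous_sform] continuous_intros) auto
  then have "continuous_on UNIV (\<lambda>\<theta>. inverse (F (cos \<theta>, sin \<theta>) powr (1 / p)) *\<^sub>R (cos \<theta>, sin \<theta>))"
    using nz by (intro continuous_intros) auto
  then show ?thesis
    by (simp add: curve_def[abs_def] phi_def pnorm_def sform_def)
qed

lemma curve_periodic: "g (\<theta> + 2 * pi) = g \<theta>"
  by (simp add: curve_def)

lemma curve_surj:
  assumes "z \<in> C"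
  obtains \<theta> where "0 \<le> \<theta>" "\<theta> < 2 * pi" "g \<theta> = z"
proof -
  have F: "F z = 1" using assms by (simp add: C_eq)
  then have "z \<noteq> 0" using p_gt_1 by (auto simp: sform_def)
  then have n: "norm z > 0" by simp
  obtain t where t: "0 \<le> t" "t < 2 * pi" and zt: "z = norm z *\<^sub>R (cos t, sin t)"
    using polar_form[of z] by blast
  have z: "(cos t, sin t) = inverse (norm z) *\<^sub>R z"
    using n by (subst zt) simp
  have "g t = inverse ((inverse (norm z) powr p) powr (1 / p)) *\<^sub>R inverse (norm z) *\<^sub>R z"
    unfolding curve_def phi_def pnorm_def sform_def[symmetric] z sform_scale F by simp
  also have "\<dots> = z"
    using n p_gt_1 by (simp add: powr_powr)
  finally show ?thesis using that t by blast
qed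

end

section \<open>Orientation of points of the curve\<close>

lemma orient_eq: "orient P Q R = det2 P Q + det2 Q R + det2 R P"
  by (simp add: orient_def det2_def algebra_simps)

lemma orient_rotate: "orient Q R P = orient P Q R"
  by (simp add: orient_eq)

lemma orient_degenerate [simp]: "orient P Q P = 0" "orient P P Q = 0" "orient P Q Q = 0"
  by (simp_all add: orient_def det2_def)

text \<open>Cramer's rule for \<open>B\<close> in the basis \<open>A\<close>, \<open>C\<close>,
  multiplied out by the determinant.\<close>

lemma det2_cramer: "det2 A C *\<^sub>R B = det2 B C *\<^sub>R A + det2 A B *\<^sub>R C"
  by (cases A; cases B; cases C) (simp add: det2_def algebra_simps)

text \<open>When \<open>det2 A B > 0\<close>, the sign compares the coefficient sum with 1: it tells
  on which side of the line \<open>A B\<close> the point lies.\<close>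

lemma orient_combination:
  "orient A B (s *\<^sub>R A + t *\<^sub>R B) = (1 - s - t) * det2 A B"
  by (simp add: orient_def det2_def algebra_simps)

lemma convex_orient_nonneg: "convex {v. orient P Q v \<ge> 0}"
proof (rule convexI)
  fix x y and u v :: real
  assume *: "x \<in> {v. orient P Q v \<ge> 0}" "y \<in> {v. orient P Q v \<ge> 0}" "0 \<le> u" "0 \<le> v" "u + v = 1"
  have u: "u = 1 - v" using * by simp
  have "orient P Q (u *\<^sub>R x + v *\<^sub>R y) = u * orient P Q x + v * orient P Q y"
    by (simp add: u orient_def det2_def algebra_simps)
  with * show "u *\<^sub>R x + v *\<^sub>R y \<in> {v. orient P Q v \<ge> 0}" by simp
qed

context superellipse_params
begin

lemma det2_curve: "\<exists>c>0. \<forall>r \<phi>. det2 (g \<alpha>) (r *\<^sub>R (cos \<phi>, sin \<phi>)) = c * r * sin (\<phi> - \<alpha>)"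
proof -
  obtain c where "c > 0" "g \<alpha> = c *\<^sub>R (cos \<alpha>, sin \<alpha>)" using curve_polar by blast
  then show ?thesis
    by (intro exI[of _ c]) (auto simp: det2_def sin_diff algebra_simps)
qed

lemma det2_curve_curve: "\<exists>c>0. det2 (g \<alpha>) (g \<beta>) = c * sin (\<beta> - \<alpha>)"
  using det2_curve[of \<alpha>] curve_polar[of \<beta>] by (metis mult_pos_pos)

lemma det2_curve_pos:
  assumes "\<alpha> < \<beta>" "\<beta> < \<alpha> + pi"
  shows "det2 (g \<alpha>) (g \<beta>) > 0"
proof -
  have "sin (\<beta> - \<alpha>) > 0" using assms by (intro sin_gt_zero) auto
  then show ?thesis using det2_curve_curve[of \<alpha> \<beta>] by auto
qed

text \<open>Within a half turn, Cramer's rule writes the middle point as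
  \<open>s *\<^sub>R A + t *\<^sub>R E\<close> with positive coefficients. A nonpositive orientation
  would mean \<open>s + t \<le> 1\<close>, so \<open>B\<close> would be an inner point of the chord
  scaled by at most 1; strict convexity then gives \<open>F B < 1\<close>, although \<open>B\<close>
  lies on the curve.\<close>

lemma orient_curve_gap:
  assumes "\<alpha> < \<beta>" "\<beta> < \<theta>" "\<theta> < \<alpha> + pi"
  shows "orient (g \<alpha>) (g \<beta>) (g \<theta>) > 0"
proof (rule ccontr)
  define A B E where "A = g \<alpha>" and "B = g \<beta>" and "E = g \<theta>"
  have pos: "det2 A B > 0" "det2 B E > 0" "det2 A E > 0"
    using assms by (auto simp: A_def B_def E_def intro!: det2_curve_pos)
  define s t where "s = det2 B E / det2 A E" and "t = det2 A B / det2 A E"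
  have st: "s > 0" "t > 0"
    using pos by (auto simp: s_def t_def)
  assume "\<not> ?thesis"
  then have "det2 A B + det2 B E - det2 A E \<le> 0"
    unfolding orient_eq A_def B_def E_def by (simp add: det2_def mult.commute)
  then have le: "s + t \<le> 1"
    using pos by (simp add: s_def t_def field_simps)
  define u where "u = t / (s + t)"
  have u: "0 < u" "u < 1" "(s + t) * u = t" "(s + t) * (1 - u) = s"
    using st by (auto simp: u_def field_simps)
  have "A \<noteq> E"
    using pos by (auto simp: det2_def)
  have "B = s *\<^sub>R A + t *\<^sub>R E"
  proof -
    have "B = inverse (det2 A E) *\<^sub>R (det2 A E *\<^sub>R B)"
      using pos by simp
    also have "\<dots> = s *\<^sub>R A + t *\<^sub>R E"
      unfolding det2_cramer[of A E B] by (simp add: s_def t_def scaleR_add_right divide_inverse mult.commute)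
    finally show ?thesis .
  qed
  also have "\<dots> = (s + t) *\<^sub>R ((1 - u) *\<^sub>R A + u *\<^sub>R E)"
    by (simp add: scaleR_add_right u)
  finally have "F B = \<bar>s + t\<bar> powr p * F ((1 - u) *\<^sub>R A + u *\<^sub>R E)"
    by (simp only: sform_scale)
  also have "\<dots> < \<bar>s + t\<bar> powr p * ((1 - u) * F A + u * F E)"
    using sform_strict_convex[OF \<open>A \<noteq> E\<close> u(1,2)] st by (intro mult_strict_left_mono) auto
  also have "\<dots> = \<bar>s + t\<bar> powr p"
    by (simp add: A_def E_def sform_curve)
  also have "\<dots> \<le> 1"
    using powr_mono2[of p "s + t" 1] st le p_gt_1 by simp
  finally show False
    by (simp add: B_def sform_curve)
qed

text \<open>If one of the three angular gaps exceeds \<open>pi\<close>, the points fit into a half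
  turn and cyclic symmetry reduces the claim to \<open>orient_curve_gap\<close>. Otherwise the
  triangle contains the origin, and its area is a sum of three nonnegative determinants.\<close>

lemma orient_curve:
  assumes "\<alpha> < \<beta>" "\<beta> < \<theta>" "\<theta> < \<alpha> + 2 * pi"
  shows "orient (g \<alpha>) (g \<beta>) (g \<theta>) > 0"
proof -
  consider "\<theta> < \<alpha> + pi" | "\<alpha> + pi < \<beta>" | "\<beta> + pi < \<theta>"
    | "\<beta> - \<alpha> \<le> pi" "\<theta> - \<beta> \<le> pi" "\<alpha> + 2 * pi - \<theta> \<le> pi"
    by linarith
  then show ?thesis
  proof cases
    case 1
    with assms show ?thesis by (intro orient_curve_gap)
  next
    case 2
    then have "orient (g \<beta>) (g \<theta>) (g (\<alpha> + 2 * pi)) > 0"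
      using assms by (intro orient_curve_gap) auto
    then show ?thesis by (simp add: curve_periodic orient_rotate)
  next
    case 3
    then have "orient (g \<theta>) (g (\<alpha> + 2 * pi)) (g (\<beta> + 2 * pi)) > 0"
      using assms by (intro orient_curve_gap) auto
    then show ?thesis by (simp add: curve_periodic) (metis orient_rotate)
  next
    case 4
    obtain c1 c2 c3 where c: "c1 > 0" "c2 > 0" "c3 > 0"
      "det2 (g \<alpha>) (g \<beta>) = c1 * sin (\<beta> - \<alpha>)" "det2 (g \<beta>) (g \<theta>) = c2 * sin (\<theta> - \<beta>)"
      "det2 (g \<theta>) (g \<alpha>) = c3 * sin (\<alpha> + 2 * pi - \<theta>)"
      using det2_curve_curve[of \<alpha> \<beta>] det2_curve_curve[of \<beta> \<theta>]
        det2_curve_curve[of \<theta> "\<alpha> + 2 * pi"] by (auto simp: curve_periodic)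
    have ge: "sin (\<beta> - \<alpha>) \<ge> 0" "sin (\<theta> - \<beta>) \<ge> 0" "sin (\<alpha> + 2 * pi - \<theta>) \<ge> 0"
      using 4 assms by (auto intro!: sin_ge_zero)
    \<comment> \<open>Two gaps equal to \<open>pi\<close> would already fill the full turn, so at
      least one determinant is positive.\<close>
    have "\<beta> - \<alpha> < pi \<or> \<theta> - \<beta> < pi"
      using 4 assms by linarith
    then have "sin (\<beta> - \<alpha>) > 0 \<or> sin (\<theta> - \<beta>) > 0"
      using assms sin_gt_zero[of "\<beta> - \<alpha>"] sin_gt_zero[of "\<theta> - \<beta>"] by auto
    then have "c1 * sin (\<beta> - \<alpha>) + c2 * sin (\<theta> - \<beta>) > 0"
      using ge c by (auto intro: add_pos_nonneg add_nonneg_pos)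
    moreover have "c3 * sin (\<alpha> + 2 * pi - \<theta>) \<ge> 0"
      using ge c by simp
    ultimately show ?thesis
      unfolding orient_eq c by linarith
  qed
qed

section \<open>The inscribed polygons\<close>

abbreviation "V \<equiv> vert a b p"

lemma curve_periodic_nat: "g (\<theta> + 2 * pi * real n) = g \<theta>"
proof (induction n)
  case (Suc n)
  have "\<theta> + 2 * pi * real (Suc n) = (\<theta> + 2 * pi * real n) + 2 * pi"
    by (simp add: algebra_simps)
  then show ?case using Suc curve_periodic by metis
qed simp

text \<open>Periodicity removes the reduction mod \<open>m\<close>, so indices may run past
  \<open>m\<close> and the cyclic order of vertices becomes the order of natural numbers.\<close>

lemma vert_eq_curve:
  assumes "m > 0"
  shows "V m t = g (2 * pi * real t / real m)"
proof -
  have "real t = real (t mod m) + real m * real (t div m)"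
    by (metis add.commute mult_div_mod_eq of_nat_add of_nat_mult)
  then have "2 * pi * real t / real m = 2 * pi * real (t mod m) / real m + 2 * pi * real (t div m)"
    using assms by (simp add: field_simps)
  then have "g (2 * pi * real t / real m) = g (2 * pi * real (t mod m) / real m)"
    using curve_periodic_nat by metis
  then show ?thesis
    by (simp add: vert_def curve_def mult.commute mult.left_commute)
qed

lemma vert_add [simp]: "V m (t + m) = V m t" "V m (m + t) = V m t"
  by (simp_all add: vert_def)

lemma vert_mod: "V m (t mod m) = V m t"
  by (simp add: vert_def)

lemma vert_double: "m > 0 \<Longrightarrow> V (2 * m) (2 * t) = V m t"
  by (auto simp: vert_eq_curve field_simps intro!: arg_cong[of _ _ g])

lemma vert_in_D: "m > 0 \<Longrightarrow> V m t \<in> D"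
  by (simp add: vert_eq_curve curve_in_D)

lemma orient_vert:
  assumes "i < j" "j < l" "l < i + m"
  shows "orient (V m i) (V m j) (V m l) > 0"
proof -
  have m: "m > 0" using assms by linarith
  have "real l < real i + real m"
    using assms by (metis of_nat_add of_nat_less_iff)
  then have "2 * pi * real l < 2 * pi * (real i + real m)"
    by simp
  then have "2 * pi * real l / real m < 2 * pi * real i / real m + 2 * pi"
    using m by (simp add: field_simps)
  then show ?thesis
    unfolding vert_eq_curve[OF m] using assms m
    by (intro orient_curve) (auto simp: divide_strict_right_mono)
qed

lemma det2_vert_Suc:
  assumes "m \<ge> 3"
  shows "det2 (V m t) (V m (Suc t)) > 0"
proof -
  have "2 * pi * real (Suc t) / real m < 2 * pi * real t / real m + pi"
    using assms by (simp add: field_simps)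
  moreover have "m > 0" using assms by simp
  ultimately show ?thesis
    unfolding vert_eq_curve[OF \<open>m > 0\<close>] using assms
    by (intro det2_curve_pos) (auto simp: divide_strict_right_mono)
qed

text \<open>The polar angle of \<open>w\<close> lies between those of two consecutive vertices,
  whose gap is below \<open>pi\<close> since \<open>m \<ge> 3\<close>. The coefficients come from
  Cramer's rule, and the angles make their numerators nonnegative.\<close>

lemma sector_decomposition:
  assumes m: "m \<ge> 3"
  obtains t s s' where "t < m" "s \<ge> 0" "s' \<ge> 0" "w = s *\<^sub>R V m t + s' *\<^sub>R V m (Suc t)"
proof (cases "w = 0")
  case True
  show ?thesis
    by (rule that[of 0 0 0]) (use m True in auto)
next
  case False
  then have n: "norm w > 0" by simp
  obtain \<theta> where \<theta>: "0 \<le> \<theta>" "\<theta> < 2 * pi" and w: "w = norm w *\<^sub>R (cos \<theta>, sin \<theta>)"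
    using polar_form[of w] by blast
  define t where "t = nat \<lfloor>\<theta> * real m / (2 * pi)\<rfloor>"
  define x where "x = \<theta> * real m / (2 * pi)"
  have "x \<ge> 0" "x < real m"
    using \<theta> m by (auto simp: x_def field_simps)
  then have t: "real t \<le> x" "x < real t + 1" "t < m"
    unfolding t_def x_def[symmetric] by (auto simp: nat_less_iff floor_less_iff)
  have tx: "\<theta> = 2 * pi * x / real m"
    using m by (simp add: x_def)
  define A B where "A = V m t" and "B = V m (Suc t)"
  have m0: "m > 0" using m by simp
  have lo: "2 * pi * real t / real m \<le> \<theta>" and hi: "\<theta> \<le> 2 * pi * real (Suc t) / real m"
    unfolding tx using t m by (auto intro!: divide_right_mono)
  have gap: "2 * pi * real (Suc t) / real m < 2 * pi * real t / real m + pi"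
    using m by (simp add: field_simps)
  have "det2 A w \<ge> 0"
  proof -
    have "sin (\<theta> - 2 * pi * real t / real m) \<ge> 0"
      using lo hi gap by (intro sin_ge_zero) auto
    then show ?thesis
      using det2_curve[of "2 * pi * real t / real m"] n
      by (subst w) (auto simp: A_def vert_eq_curve[OF m0] simp del: scaleR_Pair intro!: mult_nonneg_nonneg)
  qed
  moreover have "det2 w B \<ge> 0"
  proof -
    have "sin (\<theta> - 2 * pi * real (Suc t) / real m) \<le> 0"
      using lo hi gap sin_ge_zero[of "- (\<theta> - 2 * pi * real (Suc t) / real m)"] unfolding sin_minus by auto
    then have "det2 B w \<le> 0"
      using det2_curve[of "2 * pi * real (Suc t) / real m"] n
      by (subst w) (auto simp: B_def vert_eq_curve[OF m0] simp del: scaleR_Pair of_nat_Suc intro!: mult_nonneg_nonpos)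
    then show ?thesis by (simp add: det2_def mult.commute)
  qed
  moreover have pos: "det2 A B > 0"
    using det2_vert_Suc[OF m] by (simp add: A_def B_def)
  moreover have "w = (det2 w B / det2 A B) *\<^sub>R A + (det2 A w / det2 A B) *\<^sub>R B"
  proof -
    have "w = inverse (det2 A B) *\<^sub>R (det2 A B *\<^sub>R w)"
      using pos by simp
    also have "\<dots> = (det2 w B / det2 A B) *\<^sub>R A + (det2 A w / det2 A B) *\<^sub>R B"
      unfolding det2_cramer[of A B w] by (simp add: scaleR_add_right divide_inverse mult.commute)
    finally show ?thesis .
  qed
  ultimately show ?thesis
    using that[of t "det2 w B / det2 A B" "det2 A w / det2 A B"] t
    by (simp add: A_def B_def)
qed

end

section \<open>Angles between an edge and its refinement\<close>

context superellipse_params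
begin

lemma curve_first_quadrant:
  assumes "0 \<le> \<theta>" "\<theta> \<le> pi / 2"
  shows "fst (g \<theta>) \<ge> 0" "snd (g \<theta>) \<ge> 0"
proof -
  obtain r where "r > 0" "g \<theta> = r *\<^sub>R (cos \<theta>, sin \<theta>)" using curve_polar by blast
  moreover have "cos \<theta> \<ge> 0" "sin \<theta> \<ge> 0"
    using assms by (auto intro!: cos_ge_zero sin_ge_zero)
  ultimately show "fst (g \<theta>) \<ge> 0" "snd (g \<theta>) \<ge> 0" by auto
qed

text \<open>On this arc the first coordinate grows exactly when the second shrinks. Both changes
  together would make \<open>det2 (g \<alpha>) (g \<beta>)\<close> negative, against the order of
  the angles.\<close>

lemma curve_mono_first_quadrant:
  assumes "0 \<le> \<alpha>" "\<alpha> \<le> \<beta>" "\<beta> \<le> pi / 2"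
  shows "fst (g \<beta>) \<le> fst (g \<alpha>)" "snd (g \<alpha>) \<le> snd (g \<beta>)"
proof -
  define x y x' y' where xy: "x = fst (g \<alpha>)" "y = snd (g \<alpha>)" "x' = fst (g \<beta>)" "y' = snd (g \<beta>)"
  have nn: "x \<ge> 0" "y \<ge> 0" "x' \<ge> 0" "y' \<ge> 0"
    unfolding xy using assms by (auto intro!: curve_first_quadrant)
  have "sin (\<beta> - \<alpha>) \<ge> 0"
    using assms by (intro sin_ge_zero) auto
  then have "det2 (g \<alpha>) (g \<beta>) \<ge> 0"
    using det2_curve_curve[of \<alpha> \<beta>] by auto
  then have det: "y * x' \<le> x * y'"
    by (simp add: det2_def xy)
  have eq: "(x / a) powr p + (y / b) powr p = (x' / a) powr p + (y' / b) powr p"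
    using sform_curve[of \<alpha>] sform_curve[of \<beta>] nn a_pos b_pos
    by (simp add: sform_def xy)
  have mono: "(s / c) powr p < (t / c) powr p" if "0 \<le> s" "s < t" "c > 0" for s t c
    using that p_gt_1 by (intro powr_less_mono2) (auto simp: divide_strict_right_mono)
  have iff: "x < x' \<longleftrightarrow> y' < y"
  proof
    assume "x < x'"
    then have "(y' / b) powr p < (y / b) powr p"
      using mono[of x x' a] nn eq a_pos by auto
    then show "y' < y"
      using mono[of y y' b] nn b_pos by (cases y y' rule: linorder_cases) auto
  next
    assume "y' < y"
    then have "(x / a) powr p < (x' / a) powr p"
      using mono[of y' y b] nn eq b_pos by auto
    then show "x < x'"
      using mono[of x' x a] nn a_pos by (cases x x' rule: linorder_cases) auto
  qed
  have "\<not> (x < x' \<and> y' < y)"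
  proof
    assume *: "x < x' \<and> y' < y"
    then have "x * y' \<le> x * y"
      using nn by (intro mult_left_mono) auto
    also have "\<dots> < x' * y"
      using * nn by (intro mult_strict_right_mono) auto
    finally show False using det by (simp add: mult.commute)
  qed
  with iff show "fst (g \<beta>) \<le> fst (g \<alpha>)" "snd (g \<alpha>) \<le> snd (g \<beta>)"
    by (auto simp: xy not_less)
qed

lemma curve_reflect_y: "g (pi - \<theta>) = (- fst (g \<theta>), snd (g \<theta>))"
  by (simp add: curve_def phi_def pnorm_def)

lemma curve_reflect_x: "g (- \<theta>) = (fst (g \<theta>), - snd (g \<theta>))"
  by (simp add: curve_def phi_def pnorm_def)

text \<open>A quarter turn interchanges the two semi-axes; this is how every quadrant is brought
  back to the first.\<close>

lemma curve_rotate: "g (\<theta> + pi / 2) = (- snd (curve b a p \<theta>), fst (curve b a p \<theta>))"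
  by (simp add: curve_def phi_def pnorm_def sin_add cos_add add.commute)

text \<open>If the arc leaves the first quadrant, two of the three points are mirror images of each
  other in the second axis.\<close>
lemma acute_angle_first_quadrant:
  assumes "0 < \<delta>" "\<delta> \<le> pi / 3" "0 \<le> \<alpha>" "\<alpha> < pi / 2"
    and axis: "\<alpha> + 2 * \<delta> > pi / 2 \<Longrightarrow> pi / 2 - \<alpha> \<in> {\<delta> / 2, \<delta>, 3 * \<delta> / 2}"
  shows "inner (g (\<alpha> + \<delta>) - g \<alpha>) (g (\<alpha> + 2 * \<delta>) - g \<alpha>) \<ge> 0"
proof -
  consider "\<alpha> + 2 * \<delta> \<le> pi / 2" | "\<alpha> = pi / 2 - \<delta> / 2" | "\<alpha> = pi / 2 - \<delta>" | "\<alpha> = pi / 2 - 3 * \<delta> / 2"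
    using axis by (fastforce simp: not_le)
  then show ?thesis
  proof cases
    case 1
    then show ?thesis
      using curve_mono_first_quadrant[of \<alpha> "\<alpha> + \<delta>"] curve_mono_first_quadrant[of \<alpha> "\<alpha> + 2 * \<delta>"] assms
      by (simp add: inner_prod_def add_nonneg_nonneg mult_nonpos_nonpos)
  next
    case 2
    have "\<alpha> + \<delta> = pi - \<alpha>"
      using 2 by (simp add: field_simps)
    then have "g (\<alpha> + \<delta>) = (- fst (g \<alpha>), snd (g \<alpha>))"
      by (simp only: curve_reflect_y)
    \<comment> \<open>The first chord is horizontal, so only first coordinates count. The bound
      \<open>\<delta> \<le> pi / 3\<close> keeps the mirror image of the third point in the first
      quadrant.\<close>
    moreover have "\<alpha> + 2 * \<delta> = pi - (pi / 2 - 3 * \<delta> / 2)"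
      using 2 by (simp add: field_simps)
    then have "fst (g (\<alpha> + 2 * \<delta>)) = - fst (g (pi / 2 - 3 * \<delta> / 2))"
      by (simp only: curve_reflect_y fst_conv)
    moreover have "fst (g (pi / 2 - 3 * \<delta> / 2)) \<ge> 0" "fst (g \<alpha>) \<ge> 0"
      using assms by (auto intro!: curve_first_quadrant)
    ultimately show ?thesis
      by (auto simp: inner_prod_def intro!: mult_nonneg_nonpos mult_nonpos_nonpos)
  next
    case 3
    have "fst (g (\<alpha> + \<delta>)) = 0"
      using 3 by (simp add: curve_def phi_def)
    moreover have "\<alpha> + 2 * \<delta> = pi - \<alpha>"
      using 3 by (simp add: field_simps)
    then have "g (\<alpha> + 2 * \<delta>) = (- fst (g \<alpha>), snd (g \<alpha>))"
      by (simp only: curve_reflect_y)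
    ultimately show ?thesis
      by (simp add: inner_prod_def algebra_simps)
  next
    case 4
    have "\<alpha> + 2 * \<delta> = pi - (\<alpha> + \<delta>)"
      using 4 by (simp add: field_simps)
    then have R: "g (\<alpha> + 2 * \<delta>) = (- fst (g (\<alpha> + \<delta>)), snd (g (\<alpha> + \<delta>)))"
      by (simp only: curve_reflect_y)
    define x y x' y' where xy: "x = fst (g (\<alpha> + \<delta>))" "y = snd (g (\<alpha> + \<delta>))" "x' = fst (g \<alpha>)" "y' = snd (g \<alpha>)"
    have "x \<le> x'" "0 \<le> x"
      unfolding xy using 4 assms
      by (auto intro!: curve_mono_first_quadrant curve_first_quadrant)
    then have "(x - x') * (- x - x') \<ge> 0"
      by (intro mult_nonpos_nonpos) auto
    then show ?thesis
      by (simp add: R inner_prod_def flip: xy)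
  qed
qed

end

lemma superellipse_params_swap: "superellipse_params a b p \<Longrightarrow> superellipse_params b a p"
  by (simp add: superellipse_params_def)

text \<open>Induction on the number of quarter turns needed to bring \<open>\<alpha>\<close> into
  the first quadrant. A turn preserves inner products and the distances to the axes, but swaps
  \<open>a\<close> and \<open>b\<close>; hence both are generalized in the induction.\<close>

lemma acute_angle:
  assumes "superellipse_params a b p" "0 < \<delta>" "\<delta> \<le> pi / 3" "0 \<le> \<alpha>" "\<alpha> < real (Suc j) * (pi / 2)"
    and "\<And>i::nat. \<alpha> < real i * (pi / 2) \<Longrightarrow> real i * (pi / 2) < \<alpha> + 2 * \<delta> \<Longrightarrow>
            real i * (pi / 2) - \<alpha> \<in> {\<delta> / 2, \<delta>, 3 * \<delta> / 2}"
  shows "inner (curve a b p (\<alpha> + \<delta>) - curve a b p \<alpha>) (curve a b p (\<alpha> + 2 * \<delta>) - curve a b p \<alpha>) \<ge> 0"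
  using assms
proof (induction j arbitrary: a b \<alpha>)
  case 0
  then interpret superellipse_params a b p by simp
  show ?case
    using 0 "0.prems"(6)[of 1] by (intro acute_angle_first_quadrant) auto
next
  case (Suc j)
  show ?case
  proof (cases "\<alpha> < pi / 2")
    case True
    interpret superellipse_params a b p by fact
    show ?thesis
      using Suc.prems(2-4) True Suc.prems(6)[of 1] by (intro acute_angle_first_quadrant) auto
  next
    case False
    interpret superellipse_params a b p by fact
    define \<alpha>' where "\<alpha>' = \<alpha> - pi / 2"
    have "inner (curve b a p (\<alpha>' + \<delta>) - curve b a p \<alpha>') (curve b a p (\<alpha>' + 2 * \<delta>) - curve b a p \<alpha>') \<ge> 0"
    proof (rule Suc.IH)
      show "\<alpha>' < real (Suc j) * (pi / 2)"
        using Suc.prems(5) by (simp add: \<alpha>'_def algebra_simps)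
      show "real i * (pi / 2) - \<alpha>' \<in> {\<delta> / 2, \<delta>, 3 * \<delta> / 2}"
        if "\<alpha>' < real i * (pi / 2)" "real i * (pi / 2) < \<alpha>' + 2 * \<delta>" for i
      proof -
        have "real (Suc i) * (pi / 2) - \<alpha> = real i * (pi / 2) - \<alpha>'"
          by (simp add: \<alpha>'_def algebra_simps)
        moreover have "\<alpha> < real (Suc i) * (pi / 2)" "real (Suc i) * (pi / 2) < \<alpha> + 2 * \<delta>"
          using that calculation unfolding \<alpha>'_def by linarith+
        then have "real (Suc i) * (pi / 2) - \<alpha> \<in> {\<delta> / 2, \<delta>, 3 * \<delta> / 2}"
          by (rule Suc.prems(6))
        ultimately show ?thesis by metis
      qed
    qed (use Suc.prems False in \<open>auto simp: \<alpha>'_def intro: superellipse_params_swap\<close>)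
    moreover have "curve a b p (\<alpha> + x) = (- snd (curve b a p (\<alpha>' + x)), fst (curve b a p (\<alpha>' + x)))" for x
      using curve_rotate[of "\<alpha>' + x"] by (simp add: \<alpha>'_def)
    from this[of 0] this[of \<delta>] this[of "2 * \<delta>"]
    have "inner (curve a b p (\<alpha> + \<delta>) - curve a b p \<alpha>) (curve a b p (\<alpha> + 2 * \<delta>) - curve a b p \<alpha>)
        = inner (curve b a p (\<alpha>' + \<delta>) - curve b a p \<alpha>') (curve b a p (\<alpha>' + 2 * \<delta>) - curve b a p \<alpha>')"
      by (simp add: inner_prod_def algebra_simps)
    ultimately show ?thesis by simp
  qed
qed

context superellipse_params
begin

text \<open>This is where the positions of the vertices matter: for three arbitrary points of the curve
  the angle may well be obtuse. Here an axis crosses the arc between two consecutive vertices at a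
  multiple of one quarter of its angle.\<close>
lemma base_angle:
  assumes "m \<ge> 3"
  shows "inner (V (2 * m) (2 * t + 1) - V m t) (V m (Suc t) - V m t) \<ge> 0"
proof -
  define \<alpha> \<delta> where "\<alpha> = 2 * pi * real t / real m" and "\<delta> = pi / real m"
  have m: "m > 0" "2 * m > 0" using assms by auto
  have v: "V m t = g \<alpha>" "V m (Suc t) = g (\<alpha> + 2 * \<delta>)" "V (2 * m) (2 * t + 1) = g (\<alpha> + \<delta>)"
    unfolding vert_eq_curve[OF m(1)] vert_eq_curve[OF m(2)] \<alpha>_def \<delta>_def
    by (auto intro!: arg_cong[of _ _ g] simp: field_simps m)
  have "inner (g (\<alpha> + \<delta>) - g \<alpha>) (g (\<alpha> + 2 * \<delta>) - g \<alpha>) \<ge> 0"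
  proof (rule acute_angle)
    show "superellipse_params a b p" by (rule superellipse_params_axioms)
    show "0 < \<delta>" "0 \<le> \<alpha>" using m by (auto simp: \<delta>_def \<alpha>_def)
    show "\<delta> \<le> pi / 3" unfolding \<delta>_def using assms by (intro divide_left_mono) auto
    have "\<alpha> \<le> 2 * pi * real t / 1"
      unfolding \<alpha>_def using assms by (intro divide_left_mono) auto
    also have "\<dots> < real (Suc (4 * t)) * (pi / 2)"
      by (simp add: algebra_simps)
    finally show "\<alpha> < real (Suc (4 * t)) * (pi / 2)" .
    fix i :: nat
    assume i: "\<alpha> < real i * (pi / 2)" "real i * (pi / 2) < \<alpha> + 2 * \<delta>"
    \<comment> \<open>The distance from \<open>\<alpha>\<close> to the axis in units of
      \<open>\<delta> / 2\<close>. It is an integer strictly between 0 and 4.\<close>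
    define d where "d = int (i * m) - int (4 * t)"
    have d: "real i * (pi / 2) - \<alpha> = real_of_int d * (\<delta> / 2)"
      using m by (simp add: d_def \<alpha>_def \<delta>_def field_simps)
    have "\<delta> > 0" by fact
    have "0 < real_of_int d * (\<delta> / 2)" "real_of_int d * (\<delta> / 2) < 4 * (\<delta> / 2)"
      using i d by linarith+
    then have "0 < d" "d < 4"
      using \<open>\<delta> > 0\<close> by (auto simp: zero_less_mult_iff)
    then have "d = 1 \<or> d = 2 \<or> d = 3" by linarith
    then show "real i * (pi / 2) - \<alpha> \<in> {\<delta> / 2, \<delta>, 3 * \<delta> / 2}"
      unfolding d by auto
  qed
  then show ?thesis by (simp only: v)
qed

lemma vert_reflect:
  assumes "i + j = m * n" "m > 0"
  shows "V m i = (fst (V m j), - snd (V m j))"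
proof -
  have "real i + real j = real m * real n"
    using assms(1) by (metis of_nat_add of_nat_mult)
  then have "real i = real m * real n - real j" by simp
  then have "2 * pi * real i / real m = - (2 * pi * real j / real m) + 2 * pi * real n"
    using assms(2) by (simp add: right_diff_distrib diff_divide_distrib)
  then show ?thesis
    unfolding vert_eq_curve[OF assms(2)] by (simp only: curve_periodic_nat curve_reflect_x)
qed

text \<open>Reflection in the horizontal axis reverses the order of the vertices and so carries the
  angle at one end of an edge to the angle at the other end.\<close>

lemma base_angle':
  assumes "m \<ge> 3"
  shows "inner (V (2 * m) (2 * t + 1) - V m (Suc t)) (V m t - V m (Suc t)) \<ge> 0"
proof -
  \<comment> \<open>A natural number congruent to \<open>- (t + 1)\<close> modulo \<open>m\<close>,
    the index of the mirror image of vertex \<open>t + 1\<close>.\<close>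
  define s where "s = (m - 1) * (t + 1)"
  have s: "s + Suc t = m * Suc t"
    using assms by (cases m) (auto simp: s_def)
  have "V m t = (fst (V m (Suc s)), - snd (V m (Suc s)))"
    by (rule vert_reflect[where n = "Suc t"]) (use assms s in auto)
  moreover have "V m (Suc t) = (fst (V m s), - snd (V m s))"
    by (rule vert_reflect[where n = "Suc t"]) (use assms s in auto)
  moreover have "V (2 * m) (2 * t + 1) = (fst (V (2 * m) (2 * s + 1)), - snd (V (2 * m) (2 * s + 1)))"
    by (rule vert_reflect[where n = "Suc t"]) (use assms s in auto)
  ultimately show ?thesis
    using base_angle[OF assms, of s] by (simp add: inner_prod_def algebra_simps)
qed

end

section \<open>Refining the projection onto the polygon\<close>

text \<open>Adding the obtuse-angle inequality at the projection \<open>w\<close> to the hypothesis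
  at \<open>z\<close> leaves the squared distance of \<open>w\<close> and \<open>z\<close> bounded
  by 0.\<close>

lemma closest_point_halfspace:
  fixes z x :: "'a::euclidean_space"
  assumes "convex S" "closed S" "z \<in> S" "inner (x - z) (closest_point S x - z) \<le> 0"
  shows "closest_point S x = z"
proof -
  define w where "w = closest_point S x"
  have "inner (x - w) (z - w) \<le> 0"
    unfolding w_def using assms(1-3) by (rule closest_point_dot)
  moreover have "inner (x - w) (z - w) + inner (x - z) (w - z) = inner (w - z) (w - z)"
    by (simp add: inner_diff inner_commute algebra_simps)
  ultimately have "inner (w - z) (w - z) \<le> 0"
    using assms(4) by (simp add: w_def)
  then have "w = z"
    by (metis eq_iff_diff_eq_0 inner_eq_zero_iff inner_ge_zero order_antisym)
  then show ?thesis
    by (simp add: w_def)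
qed

lemma inner_segment_nonpos:
  fixes n z :: "'a::real_inner"
  assumes "w \<in> closed_segment A B" "inner n (A - z) \<le> 0" "inner n (B - z) \<le> 0"
  shows "inner n (w - z) \<le> 0"
proof -
  obtain u where u: "0 \<le> u" "u \<le> 1" "w = (1 - u) *\<^sub>R A + u *\<^sub>R B"
    using assms(1) by (auto simp: in_segment)
  have "w - z = (1 - u) *\<^sub>R (A - z) + u *\<^sub>R (B - z)"
    by (simp add: u algebra_simps)
  then have "inner n (w - z) = (1 - u) * inner n (A - z) + u * inner n (B - z)"
    by (simp add: inner_add_right)
  then show ?thesis
    using u assms by (simp add: add_nonpos_nonpos mult_nonneg_nonpos)
qed

text \<open>The orientations place \<open>Q\<close> in the cone at \<open>P\<close> spanned by
  \<open>A\<close> and \<open>B\<close>. This transfers a bound from two coarse vertices to the new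
  vertex between them.\<close>

lemma inner_cone_nonpos:
  assumes "orient P A Q > 0" "orient P Q B > 0" "orient P A B > 0"
    and "inner n (A - P) \<le> 0" "inner n (B - P) \<le> 0"
  shows "inner n (Q - P) \<le> 0"
proof -
  have "orient P A B *\<^sub>R (Q - P) = orient P Q B *\<^sub>R (A - P) + orient P A Q *\<^sub>R (B - P)"
    unfolding orient_def by (rule det2_cramer)
  then have "orient P A B * inner n (Q - P) = orient P Q B * inner n (A - P) + orient P A Q * inner n (B - P)"
    by (metis inner_add_right inner_scaleR_right)
  also have "\<dots> \<le> 0"
    using assms by (intro add_nonpos_nonpos mult_nonneg_nonpos) auto
  finally show ?thesis
    using assms(3) by (simp add: mult_le_0_iff)
qed

text \<open>In the application \<open>P\<close> is the old projection, \<open>R\<close> an adjacent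
  coarse vertex and \<open>Q\<close> the new vertex between them. If \<open>w\<close> were beyond
  \<open>Q\<close>, its obtuse-angle inequalities would make \<open>x - w\<close> nonnegative along
  \<open>R - P\<close>, while the acute angle at \<open>P\<close> makes \<open>w - P\<close>
  positive there; the sum contradicts the first hypothesis.\<close>

lemma closest_on_far_edge:
  fixes P Q R w x :: "'a::real_inner"
  assumes "inner (x - P) (R - P) \<le> 0" "inner (Q - P) (R - P) \<ge> 0" "R \<noteq> P"
    and "w \<in> closed_segment Q R" "inner (x - w) (Q - w) \<le> 0" "inner (x - w) (P - w) \<le> 0"
  shows "w = Q"
proof (rule ccontr)
  assume "w \<noteq> Q"
  obtain u where u: "0 \<le> u" "u \<le> 1" "w = (1 - u) *\<^sub>R Q + u *\<^sub>R R"
    using assms(4) by (auto simp: in_segment)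
  with \<open>w \<noteq> Q\<close> have "u > 0" by (cases "u = 0") auto
  have "Q - w = - u *\<^sub>R (R - Q)"
    by (simp add: u algebra_simps)
  then have "u * inner (x - w) (R - Q) \<ge> 0"
    using assms(5) by simp
  then have RQ: "inner (x - w) (R - Q) \<ge> 0"
    using \<open>u > 0\<close> by (simp add: zero_le_mult_iff)
  have "R - P = (1 - u) *\<^sub>R (R - Q) - (P - w)"
    by (simp add: u algebra_simps)
  then have "inner (x - w) (R - P) = (1 - u) * inner (x - w) (R - Q) - inner (x - w) (P - w)"
    by (simp only: inner_diff_right[of "x - w" "(1 - u) *\<^sub>R (R - Q)"] inner_scaleR_right)
  moreover have "(1 - u) * inner (x - w) (R - Q) \<ge> 0"
    using RQ u(2) by (intro mult_nonneg_nonneg) auto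
  ultimately have "inner (x - w) (R - P) \<ge> 0"
    using assms(6) by linarith
  moreover have "w - P = (1 - u) *\<^sub>R (Q - P) + u *\<^sub>R (R - P)"
    by (simp add: u algebra_simps)
  then have "inner (w - P) (R - P) = (1 - u) * inner (Q - P) (R - P) + u * inner (R - P) (R - P)"
    by (simp add: inner_add_left)
  then have "inner (w - P) (R - P) > 0"
    using u \<open>u > 0\<close> assms(2,3) by (simp add: add_nonneg_pos mult_nonneg_nonneg)
  moreover have "inner (x - P) (R - P) = inner (x - w) (R - P) + inner (w - P) (R - P)"
    by (simp flip: inner_add_left)
  ultimately show False
    using assms(1) by linarith
qed

text \<open>In the plane a linear functional vanishing along \<open>A B\<close> is a multiple of the
  signed area over \<open>A B\<close>. This turns signs of inner products into orientations.\<close>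

lemma orthogonal_orient:
  fixes n :: "real \<times> real"
  assumes "inner n (B - A) = 0" "A \<noteq> B" "z = (1 - u) *\<^sub>R A + u *\<^sub>R B"
  obtains \<kappa> where "\<And>v. inner n (v - z) = \<kappa> * orient A B v"
proof -
  define e where "e = B - A"
  have e: "inner e e \<noteq> 0" "inner n e = 0"
    using assms by (auto simp: e_def)
  have z: "z = A + u *\<^sub>R e"
    by (simp add: assms(3) e_def algebra_simps)
  \<comment> \<open>Expansion of both vectors in the orthogonal basis formed by \<open>e\<close> and
    its quarter turn.\<close>
  have "inner e e * inner n (v - z) = inner n e * inner e (v - z) + det2 e n * det2 e (v - z)" for v
    by (simp add: inner_prod_def det2_def algebra_simps)
  moreover have "det2 e (v - z) = orient A B v" for v
    by (simp add: z orient_def e_def[symmetric] det2_def algebra_simps)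
  ultimately have "inner e e * inner n (v - z) = det2 e n * orient A B v" for v
    using e by simp
  then have "inner n (v - z) = (det2 e n / inner e e) * orient A B v" for v
    using e(1) by (simp add: nonzero_eq_divide_eq mult.commute)
  then show ?thesis using that by blast
qed

lemma exists_congruent_in_window:
  assumes "m > (0::nat)"
  obtains j' where "s \<le> j'" "j' < s + m" "j' mod m = j mod m"
proof -
  \<comment> \<open>Adding \<open>m * s\<close> keeps the truncated subtraction of \<open>s\<close>
    exact without changing the residue.\<close>
  have "s + (j + m * s - s) = j + m * s"
    using assms by (cases m) auto
  then have "(s + (j + m * s - s) mod m) mod m = j mod m"
    by (metis mod_add_right_eq mod_mult_self2)
  then show ?thesis
    using that[of "s + (j + m * s - s) mod m"] assms by auto
qed

context superellipse_params
begin

section \<open>Convex hulls of the vertices and projections onto them\<close>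

abbreviation "K m \<equiv> convex hull (V m ` {..<m})"
abbreviation "edge m t \<equiv> closed_segment (V m t) (V m (Suc t))"

lemma vert_in_K:
  assumes "m > 0"
  shows "V m t \<in> K m"
proof -
  have "V m (t mod m) \<in> V m ` {..<m}" using assms by auto
  then show ?thesis by (simp add: vert_mod hull_inc)
qed

lemma closed_K: "closed (K m)"
  by (intro compact_imp_closed compact_convex_hull finite_imp_compact) auto

lemma K_subset_D: "K m \<subseteq> D"
  by (rule hull_minimal) (auto simp: convex_D intro!: vert_in_D)

lemma edge_subset_K: "m > 0 \<Longrightarrow> edge m t \<subseteq> K m"
  by (intro closed_segment_subset vert_in_K convex_convex_hull)

lemma polygon_subset_K: "polygon a b p m \<subseteq> K m"
  unfolding polygon_def by (intro UN_least edge_subset_K) auto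

lemma orient_edge_vert:
  "orient (V m t) (V m (Suc t)) (V m j) \<ge> 0"
proof (cases "m > 0")
  case True
  then obtain j' where j': "t \<le> j'" "j' < t + m" "j' mod m = j mod m"
    using exists_congruent_in_window by blast
  then have eq: "V m j = V m j'"
    by (metis vert_mod)
  consider "j' = t" | "j' = Suc t" | "j' > Suc t"
    using j' by linarith
  then have "orient (V m t) (V m (Suc t)) (V m j') \<ge> 0"
  proof cases
    case 3
    then show ?thesis
      using orient_vert[of t "Suc t" j' m] j' by (intro less_imp_le) blast
  qed simp_all
  then show ?thesis by (simp only: eq)
\<comment> \<open>For \<open>m = 0\<close>, division by zero yields 0 and all vertices
  coincide.\<close>
qed (simp add: vert_def)

lemma orient_edge_K:
  assumes "w \<in> K m"
  shows "orient (V m t) (V m (Suc t)) w \<ge> 0"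
proof -
  have "K m \<subseteq> {v. orient (V m t) (V m (Suc t)) v \<ge> 0}"
    by (rule hull_minimal) (auto simp: convex_orient_nonneg orient_edge_vert)
  with assms show ?thesis by auto
qed

lemma polygon_edge_in_window:
  assumes "w \<in> polygon a b p m" "m > 0"
  obtains i where "s \<le> i" "i < s + m" "w \<in> edge m i"
proof -
  obtain t where t: "t < m" "w \<in> edge m t"
    using assms by (auto simp: polygon_def)
  obtain i where i: "s \<le> i" "i < s + m" "i mod m = t mod m"
    using exists_congruent_in_window[OF assms(2)] by blast
  have "V m i = V m t" "V m (Suc i) = V m (Suc t)"
    using i(3) by (metis vert_mod, metis mod_Suc_eq vert_mod)
  with t i that show ?thesis by metis
qed

text \<open>In its sector the projection is
  \<open>w = s *\<^sub>R V m t + s' *\<^sub>R V m (Suc t)\<close> with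
  \<open>s + s' \<le> 1\<close>, and equality puts it on the edge. Otherwise \<open>w\<close> can be
  moved both ways along its ray within the hull (or is 0), so \<open>x - w\<close> is orthogonal to
  \<open>w\<close> and has nonpositive inner product with every vertex. As \<open>x - w\<close> is
  itself a nonnegative combination of vertices, \<open>x = w\<close>, which is excluded.\<close>

lemma closest_point_K_in_polygon:
  assumes m: "m \<ge> 3" and x: "x \<notin> K m"
  shows "closest_point (K m) x \<in> polygon a b p m"
proof -
  define w where "w = closest_point (K m) x"
  have m0: "m > 0" using m by simp
  have w: "w \<in> K m"
    unfolding w_def using closed_K vert_in_K[OF m0] by (intro closest_point_in_set) blast+
  have dot: "inner (x - w) (v - w) \<le> 0" if "v \<in> K m" for v
    unfolding w_def using closed_K that by (intro closest_point_dot) auto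
  obtain t s s' where t: "t < m" "s \<ge> 0" "s' \<ge> 0" "w = s *\<^sub>R V m t + s' *\<^sub>R V m (Suc t)"
    using sector_decomposition[OF m] .
  have "orient (V m t) (V m (Suc t)) w \<ge> 0"
    by (rule orient_edge_K[OF w])
  then have "0 \<le> (1 - s - s') * det2 (V m t) (V m (Suc t))"
    unfolding t orient_combination .
  then have "s + s' \<le> 1"
    using det2_vert_Suc[OF m, of t] by (simp add: zero_le_mult_iff)
  show ?thesis
  proof (cases "s + s' = 1")
    case True
    then have "w = (1 - s') *\<^sub>R V m t + s' *\<^sub>R V m (Suc t)"
      using t by (simp add: algebra_simps flip: True)
    then have "w \<in> edge m t"
      using t True by (auto simp: in_segment intro!: exI[of _ s'])
    with t show ?thesis
      by (auto simp: polygon_def w_def)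
  next
    case False
    define \<sigma> where "\<sigma> = s + s'"
    have \<sigma>: "0 \<le> \<sigma>" "\<sigma> < 1" using False \<open>s + s' \<le> 1\<close> t by (auto simp: \<sigma>_def)
    have zero: "0 \<in> K m"
    proof -
      \<comment> \<open>Decomposing the negative of a vertex writes 0 as a nonnegative combination
        of vertices; dividing by the total weight makes it convex.\<close>
      obtain t s s' where *: "t < m" "s \<ge> 0" "s' \<ge> 0" "- V m 0 = s *\<^sub>R V m t + s' *\<^sub>R V m (Suc t)"
        using sector_decomposition[OF m] .
      define q where "q = 1 / (1 + s + s')"
      have q: "q > 0" "q * (1 + s + s') = 1" using * by (auto simp: q_def)
      have "q *\<^sub>R V m 0 + (q * s) *\<^sub>R V m t + (q * s') *\<^sub>R V m (Suc t) = q *\<^sub>R (V m 0 + (s *\<^sub>R V m t + s' *\<^sub>R V m (Suc t)))"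
        by (simp add: scaleR_add_right)
      also have "\<dots> = 0" by (simp flip: *(4))
      finally have "q *\<^sub>R V m 0 + (q * s) *\<^sub>R V m t + (q * s') *\<^sub>R V m (Suc t) = 0" .
      moreover have "q *\<^sub>R V m 0 + (q * s) *\<^sub>R V m t + (q * s') *\<^sub>R V m (Suc t) \<in> K m"
        using convex_sum[of "{0,1,2::nat}" "K m" "\<lambda>i. if i = 0 then q else if i = 1 then q * s else q * s'"
           "\<lambda>i. if i = 0 then V m 0 else if i = 1 then V m t else V m (Suc t)"] q * vert_in_K[OF m0]
        by (simp add: algebra_simps)
      ultimately show ?thesis by metis
    qed
    have "inner (x - w) w = 0"
    proof (cases "\<sigma> = 0")
      case True
      then have "s = 0" "s' = 0" using t by (auto simp: \<sigma>_def)
      then show ?thesis by (simp add: t)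
    next
      case False
      \<comment> \<open>Here the ray from the origin through \<open>w\<close> meets the
        edge.\<close>
      have "w /\<^sub>R \<sigma> = (1 - s' / \<sigma>) *\<^sub>R V m t + (s' / \<sigma>) *\<^sub>R V m (Suc t)"
      proof -
        have "1 - s' / \<sigma> = s / \<sigma>" using False by (simp add: \<sigma>_def field_simps)
        then show ?thesis by (simp add: t scaleR_add_right divide_inverse mult.commute)
      qed
      moreover have "s' / \<sigma> \<le> 1" "s' / \<sigma> \<ge> 0"
        using t \<sigma> False by (auto simp: \<sigma>_def divide_le_eq_1)
      ultimately have "w /\<^sub>R \<sigma> \<in> edge m t"
        by (auto simp: in_segment)
      then have "inner (x - w) (w /\<^sub>R \<sigma> - w) \<le> 0"
        using edge_subset_K[OF m0] dot by blast
      moreover have "w /\<^sub>R \<sigma> - w = (inverse \<sigma> - 1) *\<^sub>R w"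
        by (simp add: algebra_simps)
      moreover have "inverse \<sigma> - 1 > 0"
        using \<sigma> False by (simp add: field_simps)
      ultimately have "inner (x - w) w \<le> 0"
        by (simp add: mult_le_0_iff)
      moreover have "inner (x - w) (0 - w) \<le> 0"
        using dot zero by blast
      ultimately show ?thesis by simp
    qed
    then have le: "inner (x - w) (V m j) \<le> 0" for j
      using dot[OF vert_in_K[OF m0], of j] by (simp add: inner_diff_right)
    obtain t s s' where *: "s \<ge> 0" "s' \<ge> 0" "x - w = s *\<^sub>R V m t + s' *\<^sub>R V m (Suc t)"
      using sector_decomposition[OF m] .
    have "inner (x - w) (x - w) = s * inner (x - w) (V m t) + s' * inner (x - w) (V m (Suc t))"
      by (subst (2) *(3)) (simp add: inner_add_right)
    also have "\<dots> \<le> 0"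
      using * le by (intro add_nonpos_nonpos mult_nonneg_nonpos) auto
    finally have "x = w"
      by (metis eq_iff_diff_eq_0 inner_eq_zero_iff inner_ge_zero order_antisym)
    with w x show ?thesis by simp
  qed
qed

text \<open>The polygon is not convex, so uniqueness is borrowed from its hull: the projection onto
  the hull lies on the polygon, hence \<open>z\<close> is as near as it.\<close>

lemma is_proj_polygon:
  assumes m: "m \<ge> 3" and x: "x \<notin> D" and z: "is_proj (polygon a b p m) x z"
  shows "z = closest_point (K m) x"
proof (rule closest_point_unique)
  have xK: "x \<notin> K m" using x K_subset_D by blast
  show "convex (K m)" "closed (K m)" by (auto intro: closed_K)
  show "z \<in> K m" using z polygon_subset_K by (auto simp: is_proj_def)
  have "dist x z \<le> dist x (closest_point (K m) x)"
    using z closest_point_K_in_polygon[OF m xK] by (auto simp: is_proj_def)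
  then show "\<forall>v\<in>K m. dist x z \<le> dist x v"
    using closest_point_le[OF closed_K] by (meson order_trans)
qed

lemma K_subset_K_double: "K m \<subseteq> K (2 * m)"
proof (rule hull_minimal)
  show "V m ` {..<m} \<subseteq> K (2 * m)"
  proof
    fix v assume "v \<in> V m ` {..<m}"
    then obtain t where "t < m" "v = V m t" by auto
    then show "v \<in> K (2 * m)"
      using vert_in_K[of "2 * m" "2 * t"] by (simp add: vert_double)
  qed
qed auto

section \<open>The projection after one refinement\<close>

context
  fixes m :: nat and x z w :: "real \<times> real"
  assumes m: "m \<ge> 3" and x: "x \<notin> D"
    and z: "z = closest_point (K m) x" and w: "w = closest_point (K (2 * m)) x"
begin

lemma m_pos: "m > 0" "2 * m > 0" "2 * m \<ge> 3"
  using m by auto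

lemma vertex_coarse: "V m t = V (2 * m) (2 * t)"
  by (simp add: vert_double m_pos)

lemma dot_z: "v \<in> K m \<Longrightarrow> inner (x - z) (v - z) \<le> 0"
  unfolding z by (intro closest_point_dot closed_K) auto

lemma dot_w: "v \<in> K (2 * m) \<Longrightarrow> inner (x - w) (v - w) \<le> 0"
  unfolding w by (intro closest_point_dot closed_K) auto

lemma z_in_K: "z \<in> K m"
  unfolding z using vert_in_K[OF m_pos(1)] by (intro closest_point_in_set closed_K) blast

lemma x_ne_z: "x \<noteq> z"
  using z_in_K K_subset_D x by blast

lemma w_in_polygon: "w \<in> polygon a b p (2 * m)"
  unfolding w using x K_subset_D m_pos by (intro closest_point_K_in_polygon) auto

lemma w_eq_z:
  assumes "inner (x - z) (w - z) \<le> 0"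
  shows "w = z"
  unfolding w
proof (rule closest_point_halfspace)
  show "z \<in> K (2 * m)" using z_in_K K_subset_K_double by blast
  show "inner (x - z) (closest_point (K (2 * m)) x - z) \<le> 0" using assms by (simp add: w)
qed (auto intro: closed_K)

text \<open>At an inner point of an edge \<open>x - z\<close> is normal to the edge, and every fine
  vertex except the new one \<open>Q\<close> over it lies on the inner side. If \<open>w\<close>
  were on another edge, then \<open>w = z\<close>; but \<open>Q\<close> is strictly outside, which
  violates the obtuse-angle inequality at \<open>w\<close>.\<close>

lemma refined_edge_open:
  assumes "z \<in> open_segment (V m t) (V m (Suc t))"
  shows "w \<in> edge (2 * m) (2 * t) \<union> edge (2 * m) (2 * t + 1)"
proof -
  define A B Q where "A = V m t" and "B = V m (Suc t)" and "Q = V (2 * m) (2 * t + 1)"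
  obtain u where u: "0 < u" "u < 1" "z = (1 - u) *\<^sub>R A + u *\<^sub>R B" and AB: "A \<noteq> B"
    using assms by (auto simp: in_segment A_def B_def)
  have "A - z = - (u *\<^sub>R (B - A))" "B - z = (1 - u) *\<^sub>R (B - A)"
    by (simp_all add: u algebra_simps)
  moreover have "inner (x - z) (A - z) \<le> 0" "inner (x - z) (B - z) \<le> 0"
    using dot_z vert_in_K m_pos by (auto simp: A_def B_def)
  ultimately have "0 \<le> u * inner (x - z) (B - A)" "(1 - u) * inner (x - z) (B - A) \<le> 0"
    by (simp_all only: inner_minus_right inner_scaleR_right)
  then have "inner (x - z) (B - A) = 0"
    using u by (auto simp: zero_le_mult_iff mult_le_0_iff)
  then obtain \<kappa> where \<kappa>: "\<And>v. inner (x - z) (v - z) = \<kappa> * orient A B v"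
    using orthogonal_orient[OF _ AB u(3)] by blast
  \<comment> \<open>A third coarse vertex, strictly on the inner side, fixes the sign of
    \<open>\<kappa>\<close>.\<close>
  have "orient A B (V m (Suc (Suc t))) > 0"
    unfolding A_def B_def using m by (intro orient_vert) auto
  moreover have "\<kappa> * orient A B (V m (Suc (Suc t))) \<le> 0"
    unfolding \<kappa>[symmetric] using dot_z vert_in_K m_pos by auto
  ultimately have "\<kappa> \<le> 0"
    by (simp add: mult_le_0_iff)
  moreover have "\<kappa> \<noteq> 0"
    using \<kappa>[of x] x_ne_z by auto
  ultimately have \<kappa>0: "\<kappa> < 0" by simp
  obtain i where i: "2 * t \<le> i" "i < 2 * t + 2 * m" "w \<in> edge (2 * m) i"
    using polygon_edge_in_window[OF w_in_polygon m_pos(2)] by metis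
  \<comment> \<open>The upper bound is included: vertex \<open>2 * t + 2 * m\<close> is
    \<open>A\<close> again and ends the last edge of the window.\<close>
  have out: "inner (x - z) (V (2 * m) j - z) \<le> 0" if "2 * t + 2 \<le> j" "j \<le> 2 * t + 2 * m" for j
  proof -
    have "orient A B (V (2 * m) j) \<ge> 0"
    proof (cases "j = 2 * t + 2 \<or> j = 2 * t + 2 * m")
      case True
      then have "V (2 * m) j = A \<or> V (2 * m) j = B"
        by (auto simp: A_def B_def vertex_coarse)
      then show ?thesis by auto
    next
      case False
      then have "orient (V (2 * m) (2 * t)) (V (2 * m) (2 * t + 2)) (V (2 * m) j) > 0"
        using that by (intro orient_vert) auto
      then show ?thesis by (simp add: A_def B_def vertex_coarse)
    qed
    with \<kappa>0 show ?thesis by (simp add: \<kappa> mult_nonpos_nonneg)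
  qed
  consider "i = 2 * t" | "i = 2 * t + 1" | "i \<ge> 2 * t + 2"
    using i by linarith
  then show ?thesis
  proof cases
    case 3
    then have "inner (x - z) (w - z) \<le> 0"
      using i by (intro inner_segment_nonpos[OF i(3)] out) auto
    then have "w = z" by (rule w_eq_z)
    have "orient (V (2 * m) (2 * t)) (V (2 * m) (2 * t + 1)) (V (2 * m) (2 * t + 2)) > 0"
      using m by (intro orient_vert) auto
    then have "orient A B Q < 0"
      by (simp add: A_def B_def Q_def vertex_coarse orient_eq) (simp add: det2_def algebra_simps)
    then have "inner (x - z) (Q - z) > 0"
      unfolding \<kappa> using \<kappa>0 by (intro mult_neg_neg)
    moreover have "inner (x - w) (Q - w) \<le> 0"
      unfolding Q_def by (intro dot_w vert_in_K m_pos)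
    ultimately show ?thesis using \<open>w = z\<close> by simp
  qed (use i in auto)
qed

text \<open>Fine vertices away from \<open>z\<close> are either coarse or lie in the cone at
  \<open>z\<close> of two consecutive coarse ones, so edges between them force \<open>w = z\<close>.
  There remain the outer halves of the two refined edges at \<open>z\<close>; by the base angles
  \<open>w\<close> can only be their new vertex there, which an edge at \<open>z\<close>
  shares.\<close>

lemma refined_edge_vertex:
  assumes zt: "z = V m t"
  shows "w \<in> edge (2 * m) (2 * t + 2 * m - 1) \<union> edge (2 * m) (2 * t)"
proof -
  have coarse: "inner (x - z) (V m s - z) \<le> 0" for s
    using dot_z vert_in_K m_pos by blast
  have wv: "inner (x - w) (V (2 * m) j - w) \<le> 0" for j
    by (intro dot_w vert_in_K m_pos)
  have ne: "V m s \<noteq> V m (Suc s)" for s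
    using det2_vert_Suc[OF m, of s] by (auto simp: det2_def)
  have out: "inner (x - z) (V (2 * m) j - z) \<le> 0" if j: "2 * t + 2 \<le> j" "j \<le> 2 * t + 2 * m - 2" for j
  proof (cases "even j")
    case True
    then obtain s where "j = 2 * s" by blast
    then show ?thesis using coarse by (simp flip: vertex_coarse)
  next
    case False
    then obtain s where s: "j = 2 * s + 1" by (elim oddE)
    have V: "V m t = V (2 * m) (2 * t)" "V m s = V (2 * m) (2 * s)" "V m (Suc s) = V (2 * m) (2 * s + 2)"
      by (simp_all add: vertex_coarse)
    have "orient (V m t) (V m s) (V (2 * m) j) > 0" "orient (V m t) (V (2 * m) j) (V m (Suc s)) > 0"
      "orient (V m t) (V m s) (V m (Suc s)) > 0"
      unfolding V s by (rule orient_vert; use j s in linarith)+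
    then show ?thesis
      using coarse[of s] coarse[of "Suc s"] unfolding zt by (rule inner_cone_nonpos)
  qed
  obtain i where i: "2 * t \<le> i" "i < 2 * t + 2 * m" "w \<in> edge (2 * m) i"
    using polygon_edge_in_window[OF w_in_polygon m_pos(2)] by metis
  consider "i = 2 * t" | "i = 2 * t + 2 * m - 1" | "i = 2 * t + 1" | "i = 2 * t + 2 * m - 2"
    | "2 * t + 2 \<le> i" "Suc i \<le> 2 * t + 2 * m - 2"
    using i by linarith
  then show ?thesis
  proof cases
    case 3
    have "w = V (2 * m) (2 * t + 1)"
    proof (rule closest_on_far_edge)
      show "inner (x - V m t) (V m (Suc t) - V m t) \<le> 0" using coarse zt by simp
      show "w \<in> closed_segment (V (2 * m) (2 * t + 1)) (V m (Suc t))"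
        using i 3 by (simp add: vertex_coarse)
      show "inner (x - w) (V m t - w) \<le> 0" unfolding vertex_coarse by (rule wv)
      show "V m (Suc t) \<noteq> V m t" using ne by metis
    qed (rule base_angle[OF m] wv)+
    then show ?thesis by simp
  next
    case 4
    \<comment> \<open>The predecessor of \<open>t\<close> modulo \<open>m\<close>, shifted by
      \<open>m\<close> to stay in the natural numbers when \<open>t = 0\<close>.\<close>
    define s where "s = t + m - 1"
    have s: "Suc s = t + m" using m by (simp add: s_def)
    then have i': "i = 2 * s" "2 * t + 2 * m - 1 = 2 * s + 1" using 4 m by auto
    have P: "V m (Suc s) = V m t" by (simp add: s)
    have "w = V (2 * m) (2 * s + 1)"
    proof (rule closest_on_far_edge)
      show "inner (x - V m (Suc s)) (V m s - V m (Suc s)) \<le> 0" using coarse[of s] by (simp add: P zt)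
      show "w \<in> closed_segment (V (2 * m) (2 * s + 1)) (V m s)"
        using i(3) i' by (simp add: vertex_coarse closed_segment_commute)
      show "inner (x - w) (V m (Suc s) - w) \<le> 0" unfolding vertex_coarse by (rule wv)
      show "V m s \<noteq> V m (Suc s)" by (rule ne)
    qed (rule base_angle'[OF m] wv)+
    then have "w \<in> edge (2 * m) (2 * s + 1)" by simp
    then show ?thesis unfolding i'(2) by blast
  next
    case 5
    then have "inner (x - z) (w - z) \<le> 0"
      by (intro inner_segment_nonpos[OF i(3)] out) auto
    then have "w = z" by (rule w_eq_z)
    then show ?thesis by (simp add: zt vertex_coarse)
  qed (use i in auto)
qed

text \<open>Since \<open>w\<close> lies on one of the two edges, the nearer candidate is no farther
  from \<open>x\<close> than \<open>w\<close>. It belongs to the refined hull, where the nearest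
  point is unique.\<close>

lemma nearest_candidate:
  assumes "w \<in> edge (2 * m) i \<union> edge (2 * m) j"
    and "z' \<in> {edge_proj a b p (2 * m) i x, edge_proj a b p (2 * m) j x}"
    and "dist x z' \<le> dist x (edge_proj a b p (2 * m) i x)" "dist x z' \<le> dist x (edge_proj a b p (2 * m) j x)"
  shows "z' = w"
proof -
  have in_edge: "edge_proj a b p (2 * m) l x \<in> edge (2 * m) l" for l
    unfolding edge_proj_def by (intro closest_point_in_set) auto
  have "dist x z' \<le> dist x w"
    using assms closest_point_le[of "edge (2 * m) i" w x] closest_point_le[of "edge (2 * m) j" w x]
    unfolding edge_proj_def by (auto intro: order_trans)
  then have "\<forall>v\<in>K (2 * m). dist x z' \<le> dist x v"
    unfolding w using closest_point_le[OF closed_K] by (meson order_trans)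
  moreover have "z' \<in> K (2 * m)"
    using assms(2) in_edge edge_subset_K[OF m_pos(2)] by blast
  ultimately show ?thesis
    unfolding w by (intro closest_point_unique closed_K) auto
qed

lemma refine_step_closest:
  assumes "refine_step a b p x m z z'"
  shows "z' = w"
proof -
  from assms obtain t where "z \<in> open_segment (V m t) (V m (Suc t)) \<and>
          (let c1 = edge_proj a b p (2*m) (2*t) x; c2 = edge_proj a b p (2*m) (2*t+1) x in
           z' \<in> {c1, c2} \<and> dist x z' \<le> dist x c1 \<and> dist x z' \<le> dist x c2)
      \<or> z = V m t \<and>
          (let c1 = edge_proj a b p (2*m) (2*t + 2*m - 1) x; c2 = edge_proj a b p (2*m) (2*t) x in
           z' \<in> {c1, c2} \<and> dist x z' \<le> dist x c1 \<and> dist x z' \<le> dist x c2)"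
    unfolding refine_step_def by blast
  then show ?thesis
    unfolding Let_def using nearest_candidate refined_edge_open refined_edge_vertex by blast
qed

end

end

section \<open>Convergence\<close>

context superellipse_params
begin

text \<open>If \<open>F y < 1\<close>, a small step from \<open>y\<close> towards \<open>x\<close>
  would stay in the disk, contradicting the obtuse-angle inequality at \<open>y\<close>.\<close>

lemma closest_point_D_in_C:
  assumes "x \<notin> D"
  shows "closest_point D x \<in> C"
proof -
  define y where "y = closest_point D x"
  have y: "y \<in> D"
    unfolding y_def using curve_in_D by (intro closest_point_in_set closed_D) blast
  have "F y = 1"
  proof (rule ccontr)
    assume "F y \<noteq> 1"
    with y have "y \<in> {z. F z < 1}" by (simp add: D_eq)
    moreover have "open {z. F z < 1}"
      by (intro open_Collect_less continuous_sform continuous_intros)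
    ultimately obtain e where e: "e > 0" "ball y e \<subseteq> {z. F z < 1}"
      by (meson openE)
    define v where "v = y + (e / 2 / norm (x - y)) *\<^sub>R (x - y)"
    have ne: "norm (x - y) > 0" using assms y by auto
    have "dist y v = e / 2"
      using ne e by (simp add: v_def dist_norm)
    with e have "v \<in> ball y e" by simp
    with e have "F v < 1" by blast
    then have "v \<in> D" by (simp add: D_eq)
    then have "inner (x - y) (v - y) \<le> 0"
      unfolding y_def using convex_D closed_D by (intro closest_point_dot)
    moreover have "inner (x - y) (v - y) = (e / 2 / norm (x - y)) * inner (x - y) (x - y)"
      by (simp add: v_def)
    moreover have "\<dots> > 0"
      using ne e by (intro mult_pos_pos) auto
    ultimately show False by simp
  qed
  then show ?thesis by (simp add: C_eq y_def)
qed

text \<open>The curve is not convex; existence and uniqueness of its nearest point are inherited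
  from the disk, whose projection lies on the curve.\<close>

lemma is_proj_C_iff:
  assumes "x \<notin> D"
  shows "is_proj C x z \<longleftrightarrow> z = closest_point D x"
proof -
  have CD: "C \<subseteq> D" by (auto simp: C_eq D_eq)
  have le: "dist x (closest_point D x) \<le> dist x v" if "v \<in> D" for v
    using closest_point_le[OF closed_D that] .
  show ?thesis
  proof
    assume z: "is_proj C x z"
    then have "dist x z \<le> dist x (closest_point D x)"
      using closest_point_D_in_C[OF assms] by (auto simp: is_proj_def)
    then have "\<forall>v\<in>D. dist x z \<le> dist x v"
      using le order_trans by blast
    moreover have "z \<in> D" using z CD by (auto simp: is_proj_def)
    ultimately show "z = closest_point D x"
      by (intro closest_point_unique convex_D closed_D)
  next
    assume "z = closest_point D x"
    then show "is_proj C x z"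
      using closest_point_D_in_C[OF assms] le CD by (auto simp: is_proj_def)
  qed
qed

text \<open>The sequence starts at index 1, hence the shift: \<open>x (Suc n)\<close> belongs to the
  polygon with \<open>2 ^ n * k\<close> vertices.\<close>

lemma algorithm_seq_closest:
  assumes k: "k \<ge> 3" and x: "xs \<notin> D" and alg: "algorithm_seq a b p xs k x"
  shows "x (Suc n) = closest_point (K (2 ^ n * k)) xs"
proof (induction n)
  case 0
  then show ?case
    using is_proj_polygon[OF k x] alg by (simp add: algorithm_seq_def)
next
  case (Suc n)
  have "1 * 3 \<le> 2 ^ n * k" using k by (intro mult_le_mono) auto
  then have "2 ^ n * k \<ge> 3" by simp
  moreover have "refine_step a b p xs (2 ^ n * k) (x (Suc n)) (x (Suc (Suc n)))"
    using alg by (auto simp: algorithm_seq_def dest: spec[of _ "Suc n"])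
  ultimately have "x (Suc (Suc n)) = closest_point (K (2 * (2 ^ n * k))) xs"
    using refine_step_closest[OF _ x Suc refl] by blast
  then show ?case by (simp add: mult.assoc)
qed

text \<open>Rounding the polar angle of \<open>y\<close> down to a sampled one costs at most
  \<open>2 * pi / M n\<close>; continuity of the curve does the rest.\<close>

lemma vertices_approximate:
  assumes "y \<in> C" and M: "filterlim M at_top sequentially"
  obtains t where "(\<lambda>n. V (M n) (t n)) \<longlonglongrightarrow> y"
proof -
  obtain \<theta> where \<theta>: "0 \<le> \<theta>" "g \<theta> = y"
    using curve_surj[OF assms(1)] by blast
  define t where "t n = nat \<lfloor>\<theta> * real (M n) / (2 * pi)\<rfloor>" for n
  define \<phi> where "\<phi> n = 2 * pi * real (t n) / real (M n)" for n
  have M0: "\<forall>\<^sub>F n in sequentially. M n > 0"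
    by (rule eventually_compose_filterlim[OF eventually_gt_at_top M])
  have "\<bar>\<phi> n - \<theta>\<bar> \<le> 2 * pi * inverse (real (M n))" if "M n > 0" for n
  proof -
    define y where "y = \<theta> * real (M n) / (2 * pi)"
    have "y \<ge> 0" using \<theta> by (simp add: y_def)
    then have "real (t n) \<le> y" "y < real (t n) + 1"
      unfolding t_def y_def[symmetric] by linarith+
    then have "\<bar>real (t n) - y\<bar> \<le> 1" by linarith
    then have "2 * pi * inverse (real (M n)) * \<bar>real (t n) - y\<bar> \<le> 2 * pi * inverse (real (M n)) * 1"
      by (intro mult_left_mono) auto
    moreover have "\<theta> = 2 * pi * inverse (real (M n)) * y"
      using that by (simp add: y_def)
    then have "\<phi> n - \<theta> = 2 * pi * inverse (real (M n)) * (real (t n) - y)"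
      by (simp add: \<phi>_def divide_inverse algebra_simps)
    then have "\<bar>\<phi> n - \<theta>\<bar> = 2 * pi * inverse (real (M n)) * \<bar>real (t n) - y\<bar>"
      by (simp add: abs_mult)
    ultimately show ?thesis by simp
  qed
  then have "\<forall>\<^sub>F n in sequentially. norm (\<phi> n - \<theta>) \<le> 2 * pi * inverse (real (M n))"
    using M0 by (auto elim: eventually_mono)
  moreover have "filterlim (\<lambda>n. real (M n)) at_top sequentially"
    by (rule filterlim_compose[OF filterlim_real_sequentially M])
  then have "(\<lambda>n. 2 * pi * inverse (real (M n))) \<longlonglongrightarrow> 2 * pi * 0"
    by (intro tendsto_mult tendsto_const tendsto_inverse_0_at_top)
  then have "(\<lambda>n. 2 * pi * inverse (real (M n))) \<longlonglongrightarrow> 0" by simp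
  ultimately have "(\<lambda>n. \<phi> n - \<theta>) \<longlonglongrightarrow> 0"
    by (rule Lim_null_comparison)
  then have "\<phi> \<longlonglongrightarrow> \<theta>"
    by (simp add: LIM_zero_iff)
  then have "(\<lambda>n. g (\<phi> n)) \<longlonglongrightarrow> g \<theta>"
    using continuous_curve by (simp add: continuous_on_eq_continuous_at isCont_tendsto_compose)
  moreover have "\<forall>\<^sub>F n in sequentially. g (\<phi> n) = V (M n) (t n)"
    using M0 by (auto elim!: eventually_mono simp: vert_eq_curve \<phi>_def)
  ultimately have "(\<lambda>n. V (M n) (t n)) \<longlonglongrightarrow> y"
    unfolding \<theta>(2) by (rule Lim_transform_eventually)
  then show ?thesis by (rule that)
qed

text \<open>Each \<open>z n\<close> lies in the disk, so the obtuse angle at \<open>y\<close> bounds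
  its squared distance to \<open>y\<close> by the excess of its squared distance to \<open>x\<close>
  over that of \<open>y\<close>. Vertices tending to \<open>y\<close> drive this excess to
  0.\<close>

lemma closest_points_converge:
  assumes x: "x \<notin> D" and M: "filterlim M at_top sequentially"
  shows "(\<lambda>n. closest_point (K (M n)) x) \<longlonglongrightarrow> closest_point D x"
proof -
  define y where "y = closest_point D x"
  define z where "z n = closest_point (K (M n)) x" for n
  obtain t where t: "(\<lambda>n. V (M n) (t n)) \<longlonglongrightarrow> y"
    using vertices_approximate[OF closest_point_D_in_C[OF x] M] unfolding y_def by blast
  have M0: "\<forall>\<^sub>F n in sequentially. M n > 0"
    by (rule eventually_compose_filterlim[OF eventually_gt_at_top M])
  have bound: "(dist (z n) y)\<^sup>2 \<le> (dist x (V (M n) (t n)))\<^sup>2 - (dist x y)\<^sup>2" if "M n > 0" for n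
  proof -
    have "z n \<in> K (M n)"
      unfolding z_def using vert_in_K[OF that] by (intro closest_point_in_set closed_K) blast
    then have "z n \<in> D" using K_subset_D by blast
    then have "inner (x - y) (z n - y) \<le> 0"
      unfolding y_def using convex_D closed_D by (intro closest_point_dot)
    moreover have "(dist x (z n))\<^sup>2 = (dist x y)\<^sup>2 - 2 * inner (x - y) (z n - y) + (dist (z n) y)\<^sup>2"
      by (simp add: dist_norm power2_norm_eq_inner inner_diff inner_commute algebra_simps)
    moreover have "dist x (z n) \<le> dist x (V (M n) (t n))"
      unfolding z_def using vert_in_K[OF that] closed_K by (intro closest_point_le)
    then have "(dist x (z n))\<^sup>2 \<le> (dist x (V (M n) (t n)))\<^sup>2"
      by (intro power_mono) auto
    ultimately show ?thesis by linarith
  qed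
  have "(\<lambda>n. (dist x (V (M n) (t n)))\<^sup>2 - (dist x y)\<^sup>2) \<longlonglongrightarrow> (dist x y)\<^sup>2 - (dist x y)\<^sup>2"
    by (intro tendsto_intros t)
  then have lim: "(\<lambda>n. (dist x (V (M n) (t n)))\<^sup>2 - (dist x y)\<^sup>2) \<longlonglongrightarrow> 0"
    by simp
  have "(\<lambda>n. (dist (z n) y)\<^sup>2) \<longlonglongrightarrow> 0"
  proof (rule Lim_null_comparison[OF _ lim])
    show "\<forall>\<^sub>F n in sequentially. norm ((dist (z n) y)\<^sup>2) \<le> (dist x (V (M n) (t n)))\<^sup>2 - (dist x y)\<^sup>2"
      using M0 by (rule eventually_mono) (use bound in auto)
  qed
  then have "(\<lambda>n. sqrt ((dist (z n) y)\<^sup>2)) \<longlonglongrightarrow> sqrt 0"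
    by (rule tendsto_real_sqrt)
  then have "z \<longlonglongrightarrow> y"
    by (simp add: tendsto_dist_iff[of z])
  then show ?thesis
    by (simp add: z_def[abs_def] y_def)
qed

end

theorem theorem4p3:
  fixes a b p :: real and xs :: "real \<times> real"
  assumes "a > 0" and "b > 0" and "p > 1"
  shows "(xs \<in> superdisk a b p \<longrightarrow> (\<forall>y. is_proj (superdisk a b p) xs y \<longleftrightarrow> y = xs))
       \<and> (xs \<notin> superdisk a b p \<longrightarrow>
            (\<forall>k::nat. \<forall>x. k \<ge> 3 \<and> algorithm_seq a b p xs k x \<longrightarrow>
               (\<exists>y. (\<forall>z. is_proj (superellipse a b p) xs z \<longleftrightarrow> z = y) \<and> x \<longlonglongrightarrow> y)))"
proof (intro conjI impI allI)
  fix y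
  assume "xs \<in> superdisk a b p"
  then show "is_proj (superdisk a b p) xs y \<longleftrightarrow> y = xs"
    unfolding is_proj_def by (metis dist_eq_0_iff dist_le_zero_iff zero_le_dist)
next
  fix k :: nat and x
  assume xs: "xs \<notin> superdisk a b p" and "k \<ge> 3 \<and> algorithm_seq a b p xs k x"
  then have k: "k \<ge> 3" and alg: "algorithm_seq a b p xs k x" by auto
  interpret superellipse_params a b p using assms by unfold_locales
  have "filterlim (\<lambda>n. 2 ^ n * k) at_top sequentially"
  proof (rule filterlim_at_top_mono[OF filterlim_ident])
    have "n \<le> 2 ^ n * k" for n
    proof -
      have "n \<le> 2 ^ n * 1" by (simp add: less_imp_le)
      also have "\<dots> \<le> 2 ^ n * k" using k by (intro mult_le_mono2) auto
      finally show ?thesis .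
    qed
    then show "\<forall>\<^sub>F n in sequentially. n \<le> 2 ^ n * k" by simp
  qed
  then have "(\<lambda>n. x (Suc n)) \<longlonglongrightarrow> closest_point D xs"
    unfolding algorithm_seq_closest[OF k xs alg] by (rule closest_points_converge[OF xs])
  then have "x \<longlonglongrightarrow> closest_point D xs"
    by (rule LIMSEQ_imp_Suc)
  then show "\<exists>y. (\<forall>z. is_proj (superellipse a b p) xs z \<longleftrightarrow> z = y) \<and> x \<longlonglongrightarrow> y"
    using is_proj_C_iff[OF xs] by blast
qed

end
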